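(* Let $\mathfrak a$ be a $\mathcal U$-graded category and let $\varphi_1:\mathcal V_1\subseteq\mathcal U$ and $\varphi_2:\mathcal V_2\subseteq\mathcal U$ be two subcategories that together constitute an $\infty$-cover of $\mathcal U$ in $\mathsf{Cat}$. Let $\varphi:\mathcal V_1\cap\mathcal V_2\subseteq\mathcal U$ and $\alpha_i:\mathcal V_1\cap\mathcal V_2\subseteq\mathcal V_i$ be the inclusions. Then there is an exact sequence of complexes (Mayer–Vietoris sequence) $$0\longrightarrow\mathbf C_{\mathcal U}(\mathfrak a)\xrightarrow{\begin{pmatrix}\varphi_1^*\\ \varphi_2^*\end{pmatrix}}\mathbf C_{\mathcal V_1}(\mathfrak a^{\varphi_1})\oplus\mathbf C_{\mathcal V_2}(\mathfrak a^{\varphi_2})\xrightarrow{\begin{pmatrix}-\alpha_1^*&\alpha_2^*\end{pmatrix}}\mathbf C_{\mathcal V_1\cap\mathcal V_2}(\mathfrak a^{\varphi})\longrightarrow0.$$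
   Context: Fix a commutative ring $k$. For a small category $\mathcal U$, a ($k$-linear) $\mathcal U$-graded category $\mathfrak a$ consists of a set $\mathfrak a_U$ for each object $U$; a $k$-module $\mathfrak a_u(A,A')$ for each $u:U\to U'$, $A\in\mathfrak a_U$, $A'\in\mathfrak a_{U'}$; compositions $\mathfrak a_{u'}(A',A'')\otimes_k\mathfrak a_u(A,A')\to\mathfrak a_{u'u}(A,A'')$ and identities $1_A\in\mathfrak a_{1_U}(A,A)$, associative and unital. For a subcategory $\varphi:\mathcal V\subseteq\mathcal U$ (not necessarily full), $\mathfrak a^\varphi$ is the restriction of $\mathfrak a$: $\mathfrak a^\varphi_V=\mathfrak a_V$, $\mathfrak a^\varphi_v(A,A')=\mathfrak a_v(A,A')$ for $V$, $v$ in $\mathcal V$. The subcategory $\mathcal V_1\cap\mathcal V_2$ has the objects and morphisms common to $\mathcal V_1$ and $\mathcal V_2$. The subcategories constitute an $\infty$-cover of $\mathcal U$ if for every $m\ge0$ every $m$-simplex of the nerve of $\mathcal U$ (chain of $m$ composable morphisms; object if $m=0$) lies in $\mathcal V_1$ or in $\mathcal V_2$. An $n$-simplex $(u,A)$ of $\mathfrak a$ consists of $U_0\xrightarrow{u_0}\cdots\xrightarrow{u_{n-1}}U_n$ in $\mathcal U$ and $A_i\in\mathfrak a_{U_i}$; $|u|=u_{n-1}\cdots u_0$. The Hochschild complex is $$\mathbf C^n_{\mathcal U}(\mathfrak a)=\prod_{(u,A)}\mathrm{Hom}_k(\mathfrak a_{u_{n-1}}(A_{n-1},A_n)\otimes\cdots\otimes\mathfrak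 a_{u_0}(A_0,A_1),\mathfrak a_{|u|}(A_0,A_n))$$ with the usual Hochschild differential. For an inclusion of a subcategory, the induced map on Hochschild complexes (denoted $\varphi_i^*$, $\alpha_i^*$) is the projection onto the factors indexed by simplices in the subcategory. *)

theory Defs
  imports "HOL-Algebra.Module"
begin

section \<open>Modules and complexes of modules\<close>

definition mod_hom ::
  "('k, 'r) ring_scheme \<Rightarrow> ('k, 'x) module \<Rightarrow> ('k, 'y) module \<Rightarrow> ('x \<Rightarrow> 'y) set"
  where "mod_hom k M N =
    {f \<in> carrier M \<rightarrow> carrier N.
       (\<forall>x\<in>carrier M. \<forall>y\<in>carrier M. f (x \<oplus>\<^bsub>M\<^esub> y) = f x \<oplus>\<^bsub>N\<^esub> f y) \<and>
       (\<forall>c\<in>carrier k. \<forall>x\<in>carrier M. f (c \<odot>\<^bsub>M\<^esub> x) = c \<odot>\<^bsub>N\<^esub> f x)}"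

text \<open>
  The module \<open>Hom\<^sub>k(M\<^sub>0 \<otimes> \<dots> \<otimes> M\<^sub>n\<^sub>-\<^sub>1, N)\<close>, given as the module of \<open>k\<close>-multilinear maps: functions on
  the lists \<open>[x\<^sub>0, \<dots>, x\<^sub>n\<^sub>-\<^sub>1]\<close> with \<open>x\<^sub>i \<in> M\<^sub>i\<close>, set to \<open>undefined\<close> elsewhere. The empty
  list \<open>Ms\<close> gives \<open>Hom\<^sub>k(k, N) = N\<close>. The fields \<open>mult\<close> and \<open>one\<close>, here and below, are
  inherited from the ring record and play no role in the notion of a module.
\<close>

definition multilinear_module ::
  "('k, 'r) ring_scheme \<Rightarrow> ('k, 'x) module list \<Rightarrow> ('k, 'x) module \<Rightarrow> ('k, 'x list \<Rightarrow> 'x) module"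
  where "multilinear_module k Ms N =
   (let D = listset (map carrier Ms) in
    \<lparr>carrier =
       {f \<in> D \<rightarrow>\<^sub>E carrier N.
          \<forall>i<length Ms. \<forall>xs\<in>D. (\<lambda>x. f (xs[i := x])) \<in> mod_hom k (Ms ! i) N},
     mult = undefined, one = undefined,
     zero = (\<lambda>xs\<in>D. \<zero>\<^bsub>N\<^esub>),
     add = (\<lambda>f g. \<lambda>xs\<in>D. f xs \<oplus>\<^bsub>N\<^esub> g xs),
     smult = (\<lambda>c f. \<lambda>xs\<in>D. c \<odot>\<^bsub>N\<^esub> f xs)\<rparr>)"

definition prod_module :: "'i set \<Rightarrow> ('i \<Rightarrow> ('k, 'x) module) \<Rightarrow> ('k, 'i \<Rightarrow> 'x) module"
  where "prod_module I M =
    \<lparr>carrier = (\<Pi>\<^sub>E i\<in>I. carrier (M i)),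
     mult = undefined, one = undefined,
     zero = (\<lambda>i\<in>I. \<zero>\<^bsub>M i\<^esub>),
     add = (\<lambda>f g. \<lambda>i\<in>I. f i \<oplus>\<^bsub>M i\<^esub> g i),
     smult = (\<lambda>c f. \<lambda>i\<in>I. c \<odot>\<^bsub>M i\<^esub> f i)\<rparr>"

definition dsum_module :: "('k, 'x) module \<Rightarrow> ('k, 'y) module \<Rightarrow> ('k, 'x \<times> 'y) module"
  where "dsum_module M N =
    \<lparr>carrier = carrier M \<times> carrier N,
     mult = undefined, one = undefined,
     zero = (\<zero>\<^bsub>M\<^esub>, \<zero>\<^bsub>N\<^esub>),
     add = (\<lambda>(x, y) (x', y'). (x \<oplus>\<^bsub>M\<^esub> x', y \<oplus>\<^bsub>N\<^esub> y')),
     smult = (\<lambda>c (x, y). (c \<odot>\<^bsub>M\<^esub> x, c \<odot>\<^bsub>N\<^esub> y))\<rparr>"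

text \<open>Cochain complexes are concentrated in degrees \<open>n \<ge> 0\<close>.\<close>

record ('k, 'x) cplx =
  Deg :: "nat \<Rightarrow> ('k, 'x) module"
  Diff :: "nat \<Rightarrow> 'x \<Rightarrow> 'x"

definition cochain_complex :: "('k, 'r) ring_scheme \<Rightarrow> ('k, 'x) cplx \<Rightarrow> bool"
  where "cochain_complex k C \<longleftrightarrow>
    (\<forall>n. module k (Deg C n) \<and>
         Diff C n \<in> mod_hom k (Deg C n) (Deg C (Suc n)) \<and>
         (\<forall>x\<in>carrier (Deg C n). Diff C (Suc n) (Diff C n x) = \<zero>\<^bsub>Deg C (Suc (Suc n))\<^esub>))"

definition cochain_map ::
  "('k, 'r) ring_scheme \<Rightarrow> ('k, 'x) cplx \<Rightarrow> ('k, 'y) cplx \<Rightarrow> (nat \<Rightarrow> 'x \<Rightarrow> 'y) \<Rightarrow> bool"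
  where "cochain_map k C D f \<longleftrightarrow>
    (\<forall>n. f n \<in> mod_hom k (Deg C n) (Deg D n) \<and>
         (\<forall>x\<in>carrier (Deg C n). f (Suc n) (Diff C n x) = Diff D n (f n x)))"

definition dsum_cplx :: "('k, 'x) cplx \<Rightarrow> ('k, 'y) cplx \<Rightarrow> ('k, 'x \<times> 'y) cplx"
  where "dsum_cplx C D =
    \<lparr>Deg = (\<lambda>n. dsum_module (Deg C n) (Deg D n)),
     Diff = (\<lambda>n (x, y). (Diff C n x, Diff D n y))\<rparr>"

definition short_exact_cplx ::
  "('k, 'r) ring_scheme \<Rightarrow> ('k, 'x) cplx \<Rightarrow> ('k, 'y) cplx \<Rightarrow> ('k, 'z) cplx \<Rightarrow>
   (nat \<Rightarrow> 'x \<Rightarrow> 'y) \<Rightarrow> (nat \<Rightarrow> 'y \<Rightarrow> 'z) \<Rightarrow> bool"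
  where "short_exact_cplx k A B C f g \<longleftrightarrow>
    cochain_complex k A \<and> cochain_complex k B \<and> cochain_complex k C \<and>
    cochain_map k A B f \<and> cochain_map k B C g \<and>
    (\<forall>n. inj_on (f n) (carrier (Deg A n)) \<and>
         f n ` carrier (Deg A n) = {y \<in> carrier (Deg B n). g n y = \<zero>\<^bsub>Deg C n\<^esub>} \<and>
         g n ` carrier (Deg B n) = carrier (Deg C n))"


section \<open>Small categories, subcategories and nerves\<close>

record ('o, 'm) cat =
  Obj :: "'o set"
  Arr :: "'m set"
  Dom :: "'m \<Rightarrow> 'o"
  Cod :: "'m \<Rightarrow> 'o"
  Ide :: "'o \<Rightarrow> 'm"
  Comp :: "'m \<Rightarrow> 'm \<Rightarrow> 'm"

text \<open>\<open>Comp C v u\<close> is the composite \<open>v u\<close>, first \<open>u\<close> and then \<open>v\<close>.\<close>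

locale category =
  fixes C :: "('o, 'm) cat"
  assumes Dom_in: "u \<in> Arr C \<Longrightarrow> Dom C u \<in> Obj C"
    and Cod_in: "u \<in> Arr C \<Longrightarrow> Cod C u \<in> Obj C"
    and Ide_in: "U \<in> Obj C \<Longrightarrow> Ide C U \<in> Arr C"
    and Dom_Ide: "U \<in> Obj C \<Longrightarrow> Dom C (Ide C U) = U"
    and Cod_Ide: "U \<in> Obj C \<Longrightarrow> Cod C (Ide C U) = U"
    and Comp_in: "\<lbrakk>u \<in> Arr C; v \<in> Arr C; Cod C u = Dom C v\<rbrakk> \<Longrightarrow> Comp C v u \<in> Arr C"
    and Dom_Comp: "\<lbrakk>u \<in> Arr C; v \<in> Arr C; Cod C u = Dom C v\<rbrakk> \<Longrightarrow> Dom C (Comp C v u) = Dom C u"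
    and Cod_Comp: "\<lbrakk>u \<in> Arr C; v \<in> Arr C; Cod C u = Dom C v\<rbrakk> \<Longrightarrow> Cod C (Comp C v u) = Cod C v"
    and Comp_Ide_left: "u \<in> Arr C \<Longrightarrow> Comp C (Ide C (Cod C u)) u = u"
    and Comp_Ide_right: "u \<in> Arr C \<Longrightarrow> Comp C u (Ide C (Dom C u)) = u"
    and Comp_assoc:
      "\<lbrakk>u \<in> Arr C; v \<in> Arr C; w \<in> Arr C; Cod C u = Dom C v; Cod C v = Dom C w\<rbrakk>
       \<Longrightarrow> Comp C w (Comp C v u) = Comp C (Comp C w v) u"

definition subcategory :: "('o, 'm) cat \<Rightarrow> ('o, 'm) cat \<Rightarrow> bool"
  where "subcategory V U \<longleftrightarrow>
    category V \<and> Obj V \<subseteq> Obj U \<and> Arr V \<subseteq> Arr U \<and>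
    (\<forall>v\<in>Arr V. Dom V v = Dom U v \<and> Cod V v = Cod U v) \<and>
    (\<forall>X\<in>Obj V. Ide V X = Ide U X) \<and>
    (\<forall>v\<in>Arr V. \<forall>w\<in>Arr V. Cod V v = Dom V w \<longrightarrow> Comp V w v = Comp U w v)"

text \<open>
  For two subcategories of the same category, the structure maps of \<open>V\<close> and of \<open>W\<close> agree on
  the common objects and morphisms, so those of \<open>V\<close> may be used.
\<close>

definition cat_inter :: "('o, 'm) cat \<Rightarrow> ('o, 'm) cat \<Rightarrow> ('o, 'm) cat"
  where "cat_inter V W = V\<lparr>Obj := Obj V \<inter> Obj W, Arr := Arr V \<inter> Arr W\<rparr>"

text \<open>
  The \<open>n\<close>-simplex \<open>U\<^sub>0 \<rightarrow> \<dots> \<rightarrow> U\<^sub>n\<close> of the nerve, with arrows \<open>u\<^sub>0, \<dots>, u\<^sub>n\<^sub>-\<^sub>1\<close>, is the pair of lists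
  \<open>([U\<^sub>0, \<dots>, U\<^sub>n], [u\<^sub>0, \<dots>, u\<^sub>n\<^sub>-\<^sub>1])\<close>.
\<close>

definition nerve :: "('o, 'm) cat \<Rightarrow> nat \<Rightarrow> ('o list \<times> 'm list) set"
  where "nerve C n =
    {(Us, us). length Us = Suc n \<and> length us = n \<and> set Us \<subseteq> Obj C \<and> set us \<subseteq> Arr C \<and>
       (\<forall>i<n. Dom C (us ! i) = Us ! i \<and> Cod C (us ! i) = Us ! Suc i)}"

definition infty_cover :: "('o, 'm) cat \<Rightarrow> ('o, 'm) cat set \<Rightarrow> bool"
  where "infty_cover U \<V> \<longleftrightarrow> (\<forall>m. nerve U m \<subseteq> (\<Union>V\<in>\<V>. nerve V m))"

text \<open>The composite \<open>|u| = u\<^sub>n\<^sub>-\<^sub>1 \<dots> u\<^sub>0\<close>, which is \<open>1\<^bsub>U\<^sub>0\<^esub>\<close> for \<open>n = 0\<close>.\<close>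

definition total :: "('o, 'm) cat \<Rightarrow> 'o list \<Rightarrow> 'm list \<Rightarrow> 'm"
  where "total C Us us = fold (Comp C) us (Ide C (hd Us))"


section \<open>Graded categories\<close>

text \<open>
  \<open>Fib a U\<close> is the set \<open>a\<^sub>U\<close>; \<open>GHom a u A A'\<close> is the module \<open>a\<^sub>u(A, A')\<close>; \<open>GComp a u' u A A' A''\<close>
  is the composition of \<open>g \<in> a\<^bsub>u'\<^esub>(A', A'')\<close> with \<open>f \<in> a\<^sub>u(A, A')\<close>; and \<open>GIde a U A\<close> is the
  identity in \<open>a\<^bsub>1\<^sub>U\<^esub>(A, A)\<close>. The sets \<open>a\<^sub>U\<close> need not be disjoint, and neither need the
  carriers of the modules.
\<close>

record ('o, 'm, 'a, 'k, 'x) gcat =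
  Fib :: "'o \<Rightarrow> 'a set"
  GHom :: "'m \<Rightarrow> 'a \<Rightarrow> 'a \<Rightarrow> ('k, 'x) module"
  GComp :: "'m \<Rightarrow> 'm \<Rightarrow> 'a \<Rightarrow> 'a \<Rightarrow> 'a \<Rightarrow> 'x \<Rightarrow> 'x \<Rightarrow> 'x"
  GIde :: "'o \<Rightarrow> 'a \<Rightarrow> 'x"

locale graded_category = category U
  for k :: "('k, 'r) ring_scheme" and U :: "('o, 'm) cat"
    and a :: "('o, 'm, 'a, 'k, 'x) gcat" +
  assumes GHom_module:
      "\<lbrakk>u \<in> Arr U; A \<in> Fib a (Dom U u); A' \<in> Fib a (Cod U u)\<rbrakk> \<Longrightarrow> module k (GHom a u A A')"
    and GComp_linear_right:
      "\<lbrakk>u \<in> Arr U; u' \<in> Arr U; Cod U u = Dom U u';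
        A \<in> Fib a (Dom U u); A' \<in> Fib a (Cod U u); A'' \<in> Fib a (Cod U u');
        g \<in> carrier (GHom a u' A' A'')\<rbrakk>
       \<Longrightarrow> GComp a u' u A A' A'' g \<in> mod_hom k (GHom a u A A') (GHom a (Comp U u' u) A A'')"
    and GComp_linear_left:
      "\<lbrakk>u \<in> Arr U; u' \<in> Arr U; Cod U u = Dom U u';
        A \<in> Fib a (Dom U u); A' \<in> Fib a (Cod U u); A'' \<in> Fib a (Cod U u');
        f \<in> carrier (GHom a u A A')\<rbrakk>
       \<Longrightarrow> (\<lambda>g. GComp a u' u A A' A'' g f)
            \<in> mod_hom k (GHom a u' A' A'') (GHom a (Comp U u' u) A A'')"
    and GIde_in:
      "\<lbrakk>X \<in> Obj U; A \<in> Fib a X\<rbrakk> \<Longrightarrow> GIde a X A \<in> carrier (GHom a (Ide U X) A A)"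
    and GComp_assoc:
      "\<lbrakk>u \<in> Arr U; u' \<in> Arr U; u'' \<in> Arr U; Cod U u = Dom U u'; Cod U u' = Dom U u'';
        A \<in> Fib a (Dom U u); A' \<in> Fib a (Cod U u); A'' \<in> Fib a (Cod U u');
        A''' \<in> Fib a (Cod U u'');
        f \<in> carrier (GHom a u A A'); g \<in> carrier (GHom a u' A' A'');
        h \<in> carrier (GHom a u'' A'' A''')\<rbrakk>
       \<Longrightarrow> GComp a u'' (Comp U u' u) A A'' A''' h (GComp a u' u A A' A'' g f)
          = GComp a (Comp U u'' u') u A A' A''' (GComp a u'' u' A' A'' A''' h g) f"
    and GComp_GIde_left:
      "\<lbrakk>u \<in> Arr U; A \<in> Fib a (Dom U u); A' \<in> Fib a (Cod U u); f \<in> carrier (GHom a u A A')\<rbrakk>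
       \<Longrightarrow> GComp a (Ide U (Cod U u)) u A A' A' (GIde a (Cod U u) A') f = f"
    and GComp_GIde_right:
      "\<lbrakk>u \<in> Arr U; A \<in> Fib a (Dom U u); A' \<in> Fib a (Cod U u); f \<in> carrier (GHom a u A A')\<rbrakk>
       \<Longrightarrow> GComp a u (Ide U (Dom U u)) A A A' f (GIde a (Dom U u) A) = f"

text \<open>The restriction of \<open>a\<close> along the inclusion of the subcategory \<open>V\<close>.\<close>

definition gcat_restrict ::
  "('o, 'm) cat \<Rightarrow> ('o, 'm, 'a, 'k, 'x) gcat \<Rightarrow> ('o, 'm, 'a, 'k, 'x) gcat"
  where "gcat_restrict V a =
    \<lparr>Fib = restrict (Fib a) (Obj V),
     GHom = restrict (GHom a) (Arr V),
     GComp = (\<lambda>u'\<in>Arr V. \<lambda>u\<in>Arr V. GComp a u' u),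
     GIde = restrict (GIde a) (Obj V)\<rparr>"


section \<open>The Hochschild complex\<close>

type_synonym ('o, 'm, 'a) gsimplex = "'o list \<times> 'm list \<times> 'a list"

definition gsimplices ::
  "('o, 'm) cat \<Rightarrow> ('o, 'm, 'a, 'k, 'x) gcat \<Rightarrow> nat \<Rightarrow> ('o, 'm, 'a) gsimplex set"
  where "gsimplices U a n =
    {(Us, us, As). (Us, us) \<in> nerve U n \<and> length As = Suc n \<and>
       (\<forall>i\<le>n. As ! i \<in> Fib a (Us ! i))}"

fun factors :: "('o, 'm, 'a, 'k, 'x) gcat \<Rightarrow> ('o, 'm, 'a) gsimplex \<Rightarrow> ('k, 'x) module list"
  where "factors a (Us, us, As) =
    map (\<lambda>i. GHom a (us ! i) (As ! i) (As ! Suc i)) [0..<length us]"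

fun target ::
  "('o, 'm) cat \<Rightarrow> ('o, 'm, 'a, 'k, 'x) gcat \<Rightarrow> ('o, 'm, 'a) gsimplex \<Rightarrow> ('k, 'x) module"
  where "target U a (Us, us, As) = GHom a (total U Us us) (hd As) (last As)"

definition hochschild_module ::
  "('k, 'r) ring_scheme \<Rightarrow> ('o, 'm) cat \<Rightarrow> ('o, 'm, 'a, 'k, 'x) gcat \<Rightarrow> nat \<Rightarrow>
   ('k, ('o, 'm, 'a) gsimplex \<Rightarrow> 'x list \<Rightarrow> 'x) module"
  where "hochschild_module k U a n =
    prod_module (gsimplices U a n) (\<lambda>\<sigma>. multilinear_module k (factors a \<sigma>) (target U a \<sigma>))"

definition delete_nth :: "nat \<Rightarrow> 'b list \<Rightarrow> 'b list"
  where "delete_nth i xs = take i xs @ drop (Suc i) xs"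

text \<open>
  Replaces the adjacent entries \<open>x\<^sub>i\<^sub>-\<^sub>1, x\<^sub>i\<close> by the single entry \<open>p x\<^sub>i x\<^sub>i\<^sub>-\<^sub>1\<close>, for
  \<open>0 < i < length xs\<close>.
\<close>

definition merge_nth :: "nat \<Rightarrow> ('b \<Rightarrow> 'b \<Rightarrow> 'b) \<Rightarrow> 'b list \<Rightarrow> 'b list"
  where "merge_nth i p xs = take (i - 1) xs @ p (xs ! i) (xs ! (i - 1)) # drop (Suc i) xs"

definition signed :: "('k, 'x) module \<Rightarrow> nat \<Rightarrow> 'x \<Rightarrow> 'x"
  where "signed M j x = (if even j then x else \<ominus>\<^bsub>M\<^esub> x)"

text \<open>
  With arguments listed as \<open>[f\<^sub>0, \<dots>, f\<^sub>n]\<close>, the three summands are those of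
  \<open>(d\<phi>)(f\<^sub>n, \<dots>, f\<^sub>0) = f\<^sub>n \<phi>(f\<^sub>n\<^sub>-\<^sub>1, \<dots>, f\<^sub>0)
    + \<Sum>\<^bsub>i=1\<^esub>\<^bsup>n\<^esup> (-1)\<^bsup>n+1-i\<^esup> \<phi>(f\<^sub>n, \<dots>, f\<^sub>i f\<^sub>i\<^sub>-\<^sub>1, \<dots>, f\<^sub>0)
    + (-1)\<^bsup>n+1\<^esup> \<phi>(f\<^sub>n, \<dots>, f\<^sub>1) f\<^sub>0\<close>,
  where each \<open>\<phi>\<close> is the component at the corresponding face of the simplex.
\<close>

fun hochschild_term ::
  "('o, 'm) cat \<Rightarrow> ('o, 'm, 'a, 'k, 'x) gcat \<Rightarrow> nat \<Rightarrow>
   (('o, 'm, 'a) gsimplex \<Rightarrow> 'x list \<Rightarrow> 'x) \<Rightarrow> ('o, 'm, 'a) gsimplex \<Rightarrow> 'x list \<Rightarrow> 'x"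
  where "hochschild_term U a n \<phi> (Us, us, As) fs =
    (let M = target U a (Us, us, As) in
      GComp a (last us) (total U (butlast Us) (butlast us)) (hd As) (As ! n) (last As)
        (last fs) (\<phi> (butlast Us, butlast us, butlast As) (butlast fs))
      \<oplus>\<^bsub>M\<^esub>
      finsum M (\<lambda>i. signed M (n + 1 - i)
          (\<phi> (delete_nth i Us, merge_nth i (Comp U) us, delete_nth i As)
             (merge_nth i
               (GComp a (us ! i) (us ! (i - 1)) (As ! (i - 1)) (As ! i) (As ! (i + 1))) fs)))
        {1..n}
      \<oplus>\<^bsub>M\<^esub>
      signed M (n + 1)
        (GComp a (total U (tl Us) (tl us)) (hd us) (hd As) (As ! 1) (last As)
          (\<phi> (tl Us, tl us, tl As) (tl fs)) (hd fs)))"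

definition hochschild_diff ::
  "('o, 'm) cat \<Rightarrow> ('o, 'm, 'a, 'k, 'x) gcat \<Rightarrow> nat \<Rightarrow>
   (('o, 'm, 'a) gsimplex \<Rightarrow> 'x list \<Rightarrow> 'x) \<Rightarrow> ('o, 'm, 'a) gsimplex \<Rightarrow> 'x list \<Rightarrow> 'x"
  where "hochschild_diff U a n \<phi> =
    (\<lambda>\<sigma>\<in>gsimplices U a (Suc n). \<lambda>fs\<in>listset (map carrier (factors a \<sigma>)).
       hochschild_term U a n \<phi> \<sigma> fs)"

definition hochschild_cplx ::
  "('k, 'r) ring_scheme \<Rightarrow> ('o, 'm) cat \<Rightarrow> ('o, 'm, 'a, 'k, 'x) gcat \<Rightarrow>
   ('k, ('o, 'm, 'a) gsimplex \<Rightarrow> 'x list \<Rightarrow> 'x) cplx"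
  where "hochschild_cplx k U a =
    \<lparr>Deg = hochschild_module k U a, Diff = hochschild_diff U a\<rparr>"

text \<open>
  The map induced by the inclusion of the subcategory \<open>V\<close>, from the complex of \<open>a\<close> to that of
  its restriction to \<open>V\<close>: the projection onto the factors indexed by simplices in \<open>V\<close>.
\<close>

definition hochschild_proj ::
  "('o, 'm) cat \<Rightarrow> ('o, 'm, 'a, 'k, 'x) gcat \<Rightarrow> nat \<Rightarrow>
   (('o, 'm, 'a) gsimplex \<Rightarrow> 'x list \<Rightarrow> 'x) \<Rightarrow> ('o, 'm, 'a) gsimplex \<Rightarrow> 'x list \<Rightarrow> 'x"
  where "hochschild_proj V a n \<phi> = restrict \<phi> (gsimplices V (gcat_restrict V a) n)"

end

theory Submission
  imports Defs
begin


text \<open>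
  The map induced by a subcategory forgets components, so exactness is a statement about
  index sets. Every \<open>n\<close>-simplex of the graded category lies over a simplex of the nerve of \<open>U\<close>, and the
  sets \<open>S\<^sub>1\<close>, \<open>S\<^sub>2\<close> of those lying over \<open>V1\<close>, \<open>V2\<close> satisfy \<open>S\<^sub>1 \<union> S\<^sub>2 = S\<^sub>U\<close>, by the
  covering hypothesis, and \<open>S\<^sub>1 \<inter> S\<^sub>2 = S\<^sub>V\<close>. The module attached to a simplex does not depend on the
  subcategory in which the simplex is viewed. Hence a cochain on \<open>U\<close> is determined by its two restrictions; two
  cochains with the same restriction to \<open>V\<close> glue to a cochain on \<open>U\<close>; and a cochain on \<open>V\<close> extends to
  \<open>V2\<close> by zero (\<open>hochschild_proj_surj\<close>).

  The substance is that the terms are complexes and the maps are maps of complexes. The differential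
  is the alternating sum of cofaces (\<open>hochschild_term_eq\<close>): the \<open>i\<close>th coface evaluates a
  cochain at the \<open>i\<close>th face of a simplex and of its arguments, and, for the two extreme values of \<open>i\<close>, composes the
  result with the argument left out. Two consecutive cofaces commute up to a shift of the index: on
  simplices and arguments this is \<open>face_face\<close> and \<open>face_args_face\<close>, on values it is
  \<open>compose_end_compose_end\<close>, and all three come down to associativity. The terms of the squared
  differential therefore cancel in pairs (\<open>alternating_double_sum\<close>). A face of a simplex of a
  subcategory stays in that subcategory, so the differential at such a simplex only involves
  components that the restriction keeps (\<open>hochschild_proj_diff\<close>).
\<close>

section \<open>Linear maps and modules of functions\<close>

lemma mod_homI:
  assumes "\<And>x. x \<in> carrier M \<Longrightarrow> f x \<in> carrier N"
    and "\<And>x y. \<lbrakk>x \<in> carrier M; y \<in> carrier M\<rbrakk> \<Longrightarrow> f (x \<oplus>\<^bsub>M\<^esub> y) = f x \<oplus>\<^bsub>N\<^esub> f y"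
    and "\<And>c x. \<lbrakk>c \<in> carrier k; x \<in> carrier M\<rbrakk> \<Longrightarrow> f (c \<odot>\<^bsub>M\<^esub> x) = c \<odot>\<^bsub>N\<^esub> f x"
  shows "f \<in> mod_hom k M N"
  using assms by (auto simp: mod_hom_def)

lemma mod_hom_closed: "f \<in> mod_hom k M N \<Longrightarrow> x \<in> carrier M \<Longrightarrow> f x \<in> carrier N"
  by (auto simp: mod_hom_def)

lemma mod_hom_add:
  "\<lbrakk>f \<in> mod_hom k M N; x \<in> carrier M; y \<in> carrier M\<rbrakk> \<Longrightarrow> f (x \<oplus>\<^bsub>M\<^esub> y) = f x \<oplus>\<^bsub>N\<^esub> f y"
  by (auto simp: mod_hom_def)

lemma mod_hom_smult:
  "\<lbrakk>f \<in> mod_hom k M N; c \<in> carrier k; x \<in> carrier M\<rbrakk> \<Longrightarrow> f (c \<odot>\<^bsub>M\<^esub> x) = c \<odot>\<^bsub>N\<^esub> f x"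
  by (auto simp: mod_hom_def)

lemma mod_hom_zero:
  assumes "module k M" "module k N" "f \<in> mod_hom k M N"
  shows "f \<zero>\<^bsub>M\<^esub> = \<zero>\<^bsub>N\<^esub>"
proof -
  interpret M: module k M by fact
  interpret N: module k N by fact
  have "f \<zero>\<^bsub>M\<^esub> \<oplus>\<^bsub>N\<^esub> f \<zero>\<^bsub>M\<^esub> = f \<zero>\<^bsub>M\<^esub>"
    using mod_hom_add[OF assms(3) M.zero_closed M.zero_closed] by simp
  then show ?thesis
    using mod_hom_closed[OF assms(3) M.zero_closed] by (metis N.add.r_cancel_one)
qed

lemma mod_hom_minus:
  assumes "module k M" "module k N" "f \<in> mod_hom k M N" "x \<in> carrier M"
  shows "f (\<ominus>\<^bsub>M\<^esub> x) = \<ominus>\<^bsub>N\<^esub> f x"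
proof -
  interpret M: module k M by fact
  interpret N: module k N by fact
  have "f (\<ominus>\<^bsub>M\<^esub> x) \<oplus>\<^bsub>N\<^esub> f x = \<zero>\<^bsub>N\<^esub>"
    using mod_hom_add[OF assms(3), of "\<ominus>\<^bsub>M\<^esub> x" x] mod_hom_zero[OF assms(1-3)] assms(4)
    by (simp add: M.l_neg)
  then show ?thesis
    using mod_hom_closed[OF assms(3)] assms(4) by (simp add: N.minus_equality)
qed

lemma mod_hom_finsum:
  assumes "module k M" "module k N" "f \<in> mod_hom k M N"
    and "finite I" "\<And>i. i \<in> I \<Longrightarrow> F i \<in> carrier M"
  shows "f (finsum M F I) = finsum N (\<lambda>i. f (F i)) I"
proof -
  interpret M: module k M by fact
  interpret N: module k N by fact
  show ?thesis
    using assms(4,5)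
  proof (induction I rule: finite_induct)
    case empty
    show ?case using mod_hom_zero[OF assms(1-3)] by simp
  next
    case (insert i I)
    then show ?case
      using mod_hom_closed[OF assms(3)]
      by (simp add: mod_hom_add[OF assms(3)] Pi_iff)
  qed
qed

lemma mod_hom_cong:
  "\<lbrakk>\<And>x. x \<in> carrier M \<Longrightarrow> f x = g x; module k M; g \<in> mod_hom k M N\<rbrakk> \<Longrightarrow> f \<in> mod_hom k M N"
proof -
  assume eq: "\<And>x. x \<in> carrier M \<Longrightarrow> f x = g x" and "module k M" and g: "g \<in> mod_hom k M N"
  interpret M: module k M by fact
  show ?thesis
    using g by (intro mod_homI) (auto simp: eq mod_hom_closed mod_hom_add mod_hom_smult)
qed

lemma mod_hom_id: "(\<lambda>x. x) \<in> mod_hom k M M"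
  by (simp add: mod_homI)

lemma mod_hom_comp:
  assumes "f \<in> mod_hom k M N" "g \<in> mod_hom k N P"
  shows "(\<lambda>x. g (f x)) \<in> mod_hom k M P"
  using assms by (intro mod_homI) (auto simp: mod_hom_closed mod_hom_add mod_hom_smult)

lemma zero_in_mod_hom:
  assumes "module k N"
  shows "(\<lambda>x. \<zero>\<^bsub>N\<^esub>) \<in> mod_hom k M N"
proof -
  interpret N: module k N by fact
  show ?thesis by (intro mod_homI) auto
qed

lemma add_in_mod_hom:
  assumes "module k N" "f \<in> mod_hom k M N" "g \<in> mod_hom k M N"
  shows "(\<lambda>x. f x \<oplus>\<^bsub>N\<^esub> g x) \<in> mod_hom k M N"
proof -
  interpret N: module k N by fact
  show ?thesis
    using assms(2,3)
    by (intro mod_homI)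
      (auto simp: mod_hom_closed mod_hom_add mod_hom_smult N.smult_r_distr N.add.m_ac)
qed

lemma minus_in_mod_hom:
  assumes "module k N" "f \<in> mod_hom k M N"
  shows "(\<lambda>x. \<ominus>\<^bsub>N\<^esub> f x) \<in> mod_hom k M N"
proof -
  interpret N: module k N by fact
  show ?thesis
    using assms(2)
    by (intro mod_homI)
      (auto simp: mod_hom_closed mod_hom_add mod_hom_smult N.smult_r_minus N.minus_add N.add.m_ac)
qed

lemma smult_in_mod_hom:
  assumes "module k N" "f \<in> mod_hom k M N" "c \<in> carrier k"
  shows "(\<lambda>x. c \<odot>\<^bsub>N\<^esub> f x) \<in> mod_hom k M N"
proof -
  interpret N: module k N by fact
  have "c \<odot>\<^bsub>N\<^esub> (d \<odot>\<^bsub>N\<^esub> y) = d \<odot>\<^bsub>N\<^esub> (c \<odot>\<^bsub>N\<^esub> y)" if "d \<in> carrier k" "y \<in> carrier N" for d y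
    using that assms(3) by (metis N.smult_assoc1 N.R.m_comm)
  then show ?thesis
    using assms(2,3)
    by (intro mod_homI) (auto simp: mod_hom_closed mod_hom_add mod_hom_smult N.smult_r_distr)
qed

lemma signed_in_mod_hom:
  assumes "module k N" "f \<in> mod_hom k M N"
  shows "(\<lambda>x. signed N j (f x)) \<in> mod_hom k M N"
  using assms minus_in_mod_hom[OF assms] by (cases "even j") (simp_all add: signed_def)

lemma mod_hom_signed:
  assumes "module k M" "module k N" "f \<in> mod_hom k M N" "x \<in> carrier M"
  shows "f (signed M j x) = signed N j (f x)"
  using mod_hom_minus[OF assms] by (simp add: signed_def)

lemma signed_closed:
  assumes "module k N" "x \<in> carrier N"
  shows "signed N j x \<in> carrier N"
proof -
  interpret N: module k N by fact
  show ?thesis using assms(2) by (simp add: signed_def)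
qed

lemma signed_signed:
  assumes "module k N" "x \<in> carrier N"
  shows "signed N i (signed N j x) = signed N (i + j) x"
proof -
  interpret N: module k N by fact
  show ?thesis using assms(2) by (auto simp: signed_def)
qed

lemma signed_cong: "even i = even j \<Longrightarrow> signed N i x = signed N j x"
  by (simp add: signed_def)

lemma finsum_in_mod_hom:
  assumes "module k N" "finite I" "\<And>i. i \<in> I \<Longrightarrow> F i \<in> mod_hom k M N"
  shows "(\<lambda>x. finsum N (\<lambda>i. F i x) I) \<in> mod_hom k M N"
proof -
  interpret N: module k N by fact
  have cl: "F i x \<in> carrier N" if "i \<in> I" "x \<in> carrier M" for i x
    using that assms(3) mod_hom_closed by metis
  show ?thesis
  proof (intro mod_homI)
    fix x y
    assume x: "x \<in> carrier M" and y: "y \<in> carrier M"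
    have "finsum N (\<lambda>i. F i (x \<oplus>\<^bsub>M\<^esub> y)) I = finsum N (\<lambda>i. F i x \<oplus>\<^bsub>N\<^esub> F i y) I"
      using x y cl by (intro N.finsum_cong') (auto simp: mod_hom_add[OF assms(3)])
    also have "\<dots> = finsum N (\<lambda>i. F i x) I \<oplus>\<^bsub>N\<^esub> finsum N (\<lambda>i. F i y) I"
      using x y cl by (intro N.finsum_addf) auto
    finally show "finsum N (\<lambda>i. F i (x \<oplus>\<^bsub>M\<^esub> y)) I = \<dots>" .
  next
    fix c x
    assume c: "c \<in> carrier k" and x: "x \<in> carrier M"
    have "finsum N (\<lambda>i. F i (c \<odot>\<^bsub>M\<^esub> x)) I = finsum N (\<lambda>i. c \<odot>\<^bsub>N\<^esub> F i x) I"
      using c x cl by (intro N.finsum_cong') (auto simp: mod_hom_smult[OF assms(3)])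
    also have "\<dots> = c \<odot>\<^bsub>N\<^esub> finsum N (\<lambda>i. F i x) I"
      using c x cl assms(2) by (intro N.finsum_smult_ldistr[symmetric]) auto
    finally show "finsum N (\<lambda>i. F i (c \<odot>\<^bsub>M\<^esub> x)) I = \<dots>" .
  qed (use cl in auto)
qed

lemma prod_module_simps:
  "carrier (prod_module I M) = (\<Pi>\<^sub>E i\<in>I. carrier (M i))"
  "\<zero>\<^bsub>prod_module I M\<^esub> = (\<lambda>i\<in>I. \<zero>\<^bsub>M i\<^esub>)"
  "f \<oplus>\<^bsub>prod_module I M\<^esub> g = (\<lambda>i\<in>I. f i \<oplus>\<^bsub>M i\<^esub> g i)"
  "c \<odot>\<^bsub>prod_module I M\<^esub> f = (\<lambda>i\<in>I. c \<odot>\<^bsub>M i\<^esub> f i)"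
  by (simp_all add: prod_module_def)

lemma module_prod_module:
  assumes "cring k" and M: "\<And>i. i \<in> I \<Longrightarrow> module k (M i)"
  shows "module k (prod_module I M)"
proof (rule moduleI[OF assms(1)])
  have ab: "abelian_group (M i)" if "i \<in> I" for i
    using M[OF that] by (simp add: module_def)
  then have mon: "abelian_monoid (M i)" if "i \<in> I" for i
    using that by (simp add: abelian_group_def)
  have inv: "(\<lambda>i\<in>I. \<ominus>\<^bsub>M i\<^esub> f i) \<in> (\<Pi>\<^sub>E i\<in>I. carrier (M i))" if "f \<in> (\<Pi>\<^sub>E i\<in>I. carrier (M i))" for f
    using that ab by (auto intro: abelian_group.a_inv_closed)
  show "abelian_group (prod_module I M)"
  proof (rule abelian_groupI)
    fix f
    assume f: "f \<in> carrier (prod_module I M)"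
    have "(\<lambda>i\<in>I. \<ominus>\<^bsub>M i\<^esub> f i) \<oplus>\<^bsub>prod_module I M\<^esub> f = \<zero>\<^bsub>prod_module I M\<^esub>"
      using f ab by (auto simp: prod_module_simps intro!: abelian_group.l_neg restrict_ext)
    then show "\<exists>y\<in>carrier (prod_module I M). y \<oplus>\<^bsub>prod_module I M\<^esub> f = \<zero>\<^bsub>prod_module I M\<^esub>"
      using inv f by (metis prod_module_simps(1))
  qed (use ab mon in \<open>auto simp: prod_module_simps PiE_iff abelian_monoid.a_assoc
        abelian_monoid.a_comm abelian_monoid.l_zero extensional_def
        intro!: restrict_ext ext abelian_monoid.a_closed abelian_monoid.zero_closed\<close>)
qed (use M in \<open>auto simp: prod_module_simps PiE_iff extensional_def
      cring.cring_simprules[OF assms(1)] module.smult_l_distr[OF M] module.smult_r_distr[OF M]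
      module.smult_assoc1[OF M] module.smult_one[OF M]
      intro!: restrict_ext ext module.smult_closed[OF M]\<close>)

lemma prod_module_proj:
  "i \<in> I \<Longrightarrow> (\<lambda>f. f i) \<in> mod_hom k (prod_module I M) (M i)"
  by (intro mod_homI) (auto simp: prod_module_simps)

lemma mod_hom_prod_moduleI:
  assumes "\<And>x. x \<in> carrier N \<Longrightarrow> F x \<in> extensional I"
    and "module k N"
    and F: "\<And>i. i \<in> I \<Longrightarrow> (\<lambda>x. F x i) \<in> mod_hom k N (M i)"
  shows "F \<in> mod_hom k N (prod_module I M)"
proof -
  interpret N: module k N by fact
  show ?thesis
  proof (intro mod_homI)
    fix x y assume "x \<in> carrier N" "y \<in> carrier N"
    then show "F (x \<oplus>\<^bsub>N\<^esub> y) = F x \<oplus>\<^bsub>prod_module I M\<^esub> F y"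
      using mod_hom_add[OF F] assms(1)[of "x \<oplus>\<^bsub>N\<^esub> y"]
      by (auto simp: prod_module_simps extensional_def fun_eq_iff)
  next
    fix c x assume "c \<in> carrier k" "x \<in> carrier N"
    then show "F (c \<odot>\<^bsub>N\<^esub> x) = c \<odot>\<^bsub>prod_module I M\<^esub> F x"
      using mod_hom_smult[OF F] assms(1)[of "c \<odot>\<^bsub>N\<^esub> x"]
      by (auto simp: prod_module_simps extensional_def fun_eq_iff)
  qed (use assms(1) mod_hom_closed[OF F] in \<open>auto simp: prod_module_simps PiE_iff\<close>)
qed

lemma multilinear_carrier:
  "f \<in> carrier (multilinear_module k Ms N) \<longleftrightarrow>
     f \<in> listset (map carrier Ms) \<rightarrow>\<^sub>E carrier N \<and>
     (\<forall>i<length Ms. \<forall>xs\<in>listset (map carrier Ms). (\<lambda>x. f (xs[i := x])) \<in> mod_hom k (Ms ! i) N)"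
  by (simp add: multilinear_module_def Let_def)

text \<open>
  Multilinear maps inherit the module axioms from the product over all argument lists; only
  closure remains to be checked.
\<close>

lemma multilinear_module_eq_submodule:
  "multilinear_module k Ms N =
     prod_module (listset (map carrier Ms)) (\<lambda>_. N)
       \<lparr>carrier := carrier (multilinear_module k Ms N)\<rparr>"
  by (simp add: multilinear_module_def prod_module_def Let_def)

lemma mem_listset_iff:
  "xs \<in> listset As \<longleftrightarrow> length xs = length As \<and> (\<forall>i<length As. xs ! i \<in> As ! i)"
proof (induction As arbitrary: xs)
  case (Cons A As)
  show ?case
    by (cases xs) (auto simp: set_Cons_def Cons.IH nth_Cons split: nat.splits)
qed simp

lemma list_update_in_listset:
  "\<lbrakk>xs \<in> listset As; x \<in> As ! i\<rbrakk> \<Longrightarrow> xs[i := x] \<in> listset As"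
  by (simp add: mem_listset_iff) (metis nth_list_update nth_list_update_neq)

lemma module_multilinear_module:
  assumes "module k N" and Ms: "\<And>i. i < length Ms \<Longrightarrow> module k (Ms ! i)"
  shows "module k (multilinear_module k Ms N)"
proof -
  interpret N: module k N by fact
  define D where "D = listset (map carrier Ms)"
  define P where "P = prod_module D (\<lambda>_. N)"
  interpret P: module k P
    unfolding P_def by (intro module_prod_module N.R.is_cring assms(1))
  have upd: "xs[i := x] \<in> D" if "xs \<in> D" "i < length Ms" "x \<in> carrier (Ms ! i)" for xs i x
    using that by (simp add: D_def list_update_in_listset)
  have eval: "(\<lambda>f. f xs) \<in> mod_hom k P N" if "xs \<in> D" for xs
    using prod_module_proj[OF that, of k "\<lambda>_. N"] by (simp add: P_def)
  have carrier: "f \<in> carrier (multilinear_module k Ms N) \<longleftrightarrow> f \<in> carrier P \<and>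
      (\<forall>i<length Ms. \<forall>xs\<in>D. (\<lambda>x. f (xs[i := x])) \<in> mod_hom k (Ms ! i) N)" for f
    by (simp add: multilinear_carrier P_def prod_module_simps D_def)
  have "submodule (carrier (multilinear_module k Ms N)) k P"
  proof (rule P.submoduleI)
    show "carrier (multilinear_module k Ms N) \<subseteq> carrier P"
      by (auto simp: carrier)
  next
    have "(\<lambda>x. \<zero>\<^bsub>P\<^esub> (xs[i := x])) \<in> mod_hom k (Ms ! i) N" if "i < length Ms" "xs \<in> D" for i xs
      using that upd
      by (intro mod_hom_cong[OF _ Ms zero_in_mod_hom[OF assms(1)]])
        (auto simp: P_def prod_module_simps)
    then show "\<zero>\<^bsub>P\<^esub> \<in> carrier (multilinear_module k Ms N)"
      by (auto simp: carrier)
  next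
    fix f assume f: "f \<in> carrier (multilinear_module k Ms N)"
    have "(\<lambda>x. (\<ominus>\<^bsub>P\<^esub> f) (xs[i := x])) \<in> mod_hom k (Ms ! i) N" if "i < length Ms" "xs \<in> D" for i xs
    proof (rule mod_hom_cong[OF _ Ms minus_in_mod_hom[OF assms(1)]])
      show "(\<lambda>x. f (xs[i := x])) \<in> mod_hom k (Ms ! i) N"
        using f that by (simp add: carrier)
      show "(\<ominus>\<^bsub>P\<^esub> f) (xs[i := x]) = \<ominus>\<^bsub>N\<^esub> f (xs[i := x])" if "x \<in> carrier (Ms ! i)" for x
        using f mod_hom_minus[OF P.module_axioms assms(1) eval[OF upd]] that \<open>xs \<in> D\<close> \<open>i < length Ms\<close>
        by (simp add: carrier)
    qed (use that in simp)
    then show "\<ominus>\<^bsub>P\<^esub> f \<in> carrier (multilinear_module k Ms N)"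
      using f by (auto simp: carrier)
  next
    fix f g assume f: "f \<in> carrier (multilinear_module k Ms N)" and g: "g \<in> carrier (multilinear_module k Ms N)"
    have "(\<lambda>x. (f \<oplus>\<^bsub>P\<^esub> g) (xs[i := x])) \<in> mod_hom k (Ms ! i) N" if "i < length Ms" "xs \<in> D" for i xs
    proof (rule mod_hom_cong[OF _ Ms add_in_mod_hom[OF assms(1)]])
      show "(\<lambda>x. f (xs[i := x])) \<in> mod_hom k (Ms ! i) N" "(\<lambda>x. g (xs[i := x])) \<in> mod_hom k (Ms ! i) N"
        using f g that by (simp_all add: carrier)
    qed (use that upd in \<open>auto simp: P_def prod_module_simps\<close>)
    then show "f \<oplus>\<^bsub>P\<^esub> g \<in> carrier (multilinear_module k Ms N)"
      using f g by (auto simp: carrier)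
  next
    fix c f assume c: "c \<in> carrier k" and f: "f \<in> carrier (multilinear_module k Ms N)"
    have "(\<lambda>x. (c \<odot>\<^bsub>P\<^esub> f) (xs[i := x])) \<in> mod_hom k (Ms ! i) N" if "i < length Ms" "xs \<in> D" for i xs
    proof (rule mod_hom_cong[OF _ Ms smult_in_mod_hom[OF assms(1)]])
      show "(\<lambda>x. f (xs[i := x])) \<in> mod_hom k (Ms ! i) N"
        using f that by (simp add: carrier)
    qed (use that upd c in \<open>auto simp: P_def prod_module_simps\<close>)
    then show "c \<odot>\<^bsub>P\<^esub> f \<in> carrier (multilinear_module k Ms N)"
      using c f by (auto simp: carrier)
  qed
  then have "module k (P\<lparr>carrier := carrier (multilinear_module k Ms N)\<rparr>)"
    by (rule submodule.submodule_is_module) (rule P.module_axioms)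
  then show ?thesis
    unfolding P_def D_def multilinear_module_eq_submodule[symmetric] .
qed

lemma multilinear_module_eval:
  "xs \<in> listset (map carrier Ms) \<Longrightarrow> (\<lambda>f. f xs) \<in> mod_hom k (multilinear_module k Ms N) N"
  by (intro mod_homI) (auto simp: multilinear_module_def Let_def)

lemma mod_hom_multilinear_moduleI:
  assumes "\<And>x. x \<in> carrier P \<Longrightarrow> F x \<in> carrier (multilinear_module k Ms N)"
    and "module k P"
    and "\<And>xs. xs \<in> listset (map carrier Ms) \<Longrightarrow> (\<lambda>x. F x xs) \<in> mod_hom k P N"
  shows "F \<in> mod_hom k P (multilinear_module k Ms N)"
proof -
  have "F \<in> mod_hom k P (prod_module (listset (map carrier Ms)) (\<lambda>_. N))"
    using assms by (intro mod_hom_prod_moduleI) (auto simp: multilinear_carrier PiE_iff)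
  then show ?thesis
    using assms(1)
    by (subst multilinear_module_eq_submodule) (auto simp: mod_hom_def)
qed

lemma multilinear_zero_in:
  assumes "module k N" "\<And>i. i < length Ms \<Longrightarrow> module k (Ms ! i)"
  shows "\<zero>\<^bsub>multilinear_module k Ms N\<^esub> \<in> carrier (multilinear_module k Ms N)"
  using module_multilinear_module[OF assms]
  by (simp add: module_def abelian_group_def abelian_monoid.zero_closed)

lemma dsum_module_simps:
  "carrier (dsum_module M N) = carrier M \<times> carrier N"
  "\<zero>\<^bsub>dsum_module M N\<^esub> = (\<zero>\<^bsub>M\<^esub>, \<zero>\<^bsub>N\<^esub>)"
  "(x, y) \<oplus>\<^bsub>dsum_module M N\<^esub> (x', y') = (x \<oplus>\<^bsub>M\<^esub> x', y \<oplus>\<^bsub>N\<^esub> y')"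
  "c \<odot>\<^bsub>dsum_module M N\<^esub> (x, y) = (c \<odot>\<^bsub>M\<^esub> x, c \<odot>\<^bsub>N\<^esub> y)"
  by (simp_all add: dsum_module_def)

lemma module_dsum_module:
  assumes "module k M" "module k N"
  shows "module k (dsum_module M N)"
proof -
  interpret M: module k M by fact
  interpret N: module k N by fact
  show ?thesis
  proof (rule moduleI[OF M.R.is_cring])
    show "abelian_group (dsum_module M N)"
    proof (rule abelian_groupI)
      fix p assume "p \<in> carrier (dsum_module M N)"
      then show "\<exists>q\<in>carrier (dsum_module M N). q \<oplus>\<^bsub>dsum_module M N\<^esub> p = \<zero>\<^bsub>dsum_module M N\<^esub>"
        by (intro bexI[of _ "(\<ominus>\<^bsub>M\<^esub> fst p, \<ominus>\<^bsub>N\<^esub> snd p)"])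
          (auto simp: dsum_module_simps M.l_neg N.l_neg)
    qed (auto simp: dsum_module_simps M.add.m_ac N.add.m_ac)
  qed (auto simp: dsum_module_simps M.smult_l_distr N.smult_l_distr M.smult_r_distr
      N.smult_r_distr M.smult_assoc1 N.smult_assoc1)
qed

lemma mod_hom_pair:
  "\<lbrakk>f \<in> mod_hom k P M; g \<in> mod_hom k P N\<rbrakk> \<Longrightarrow> (\<lambda>x. (f x, g x)) \<in> mod_hom k P (dsum_module M N)"
  by (intro mod_homI) (auto simp: dsum_module_simps mod_hom_closed mod_hom_add mod_hom_smult)

lemma dsum_module_fst: "fst \<in> mod_hom k (dsum_module M N) M"
  and dsum_module_snd: "snd \<in> mod_hom k (dsum_module M N) N"
  by (auto intro!: mod_homI simp: dsum_module_simps)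

lemma cochain_complex_dsum:
  assumes "cochain_complex k C" "cochain_complex k D"
  shows "cochain_complex k (dsum_cplx C D)"
proof -
  have C: "module k (Deg C n)" "Diff C n \<in> mod_hom k (Deg C n) (Deg C (Suc n))"
    and D: "module k (Deg D n)" "Diff D n \<in> mod_hom k (Deg D n) (Deg D (Suc n))" for n
    using assms by (auto simp: cochain_complex_def)
  have "(\<lambda>p. (Diff C n (fst p), Diff D n (snd p)))
      \<in> mod_hom k (dsum_module (Deg C n) (Deg D n)) (dsum_module (Deg C (Suc n)) (Deg D (Suc n)))" for n
    by (intro mod_hom_pair mod_hom_comp[OF dsum_module_fst C(2)] mod_hom_comp[OF dsum_module_snd D(2)])
  then show ?thesis
    using assms C D
    by (auto simp: cochain_complex_def dsum_cplx_def module_dsum_module dsum_module_simps case_prod_unfold)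
qed

section \<open>Alternating double sums\<close>

text \<open>
  Induction on \<open>m\<close> adds the row \<open>j = m + 2\<close> and the column \<open>i = m + 1\<close>. The hypothesis
  identifies the \<open>i\<close>th entry of the row with the \<open>i\<close>th entry of the column, where it has the opposite sign.
\<close>

lemma alternating_double_sum:
  assumes N: "module k N"
    and cl: "\<And>i j. \<lbrakk>i \<le> m; j \<le> Suc m\<rbrakk> \<Longrightarrow> T j i \<in> carrier N"
    and eq: "\<And>i j. \<lbrakk>i < j; j \<le> Suc m\<rbrakk> \<Longrightarrow> T j i = T i (j - 1)"
  shows "finsum N (\<lambda>j. finsum N (\<lambda>i. signed N (Suc (i + j)) (T j i)) {..m}) {..Suc m} = \<zero>\<^bsub>N\<^esub>"
proof -
  interpret N: module k N by fact
  show ?thesis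
    using cl eq
  proof (induction m)
    case 0
    have "T (Suc 0) 0 = T 0 0" using 0(2)[of 0 1] by simp
    moreover have "T 0 0 \<in> carrier N" using 0(1)[of 0 0] by simp
    moreover have "finsum N (\<lambda>i. signed N (Suc (i + j)) (T j i)) {..0} = signed N (Suc j) (T j 0)"
      if "j \<le> Suc 0" for j
      using that 0(1) by (subst N.finsum_0) (auto intro!: signed_closed[OF N])
    then have "finsum N (\<lambda>j. finsum N (\<lambda>i. signed N (Suc (i + j)) (T j i)) {..0}) {..Suc 0}
        = finsum N (\<lambda>j. signed N (Suc j) (T j 0)) {..Suc 0}"
      using 0(1) by (intro N.finsum_cong') (auto simp del: atMost_0 intro!: signed_closed[OF N])
    moreover have "finsum N (\<lambda>j. signed N (Suc j) (T j 0)) {..Suc 0}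
        = signed N (Suc (Suc 0)) (T (Suc 0) 0) \<oplus>\<^bsub>N\<^esub> signed N (Suc 0) (T 0 0)"
      using 0(1) signed_closed[OF N 0(1)[of 0 0], of "Suc 0"]
      by (subst N.finsum_Suc) (auto intro!: signed_closed[OF N])
    ultimately show ?case by (simp add: signed_def N.r_neg del: atMost_0)
  next
    case (Suc m)
    define t where "t j i = signed N (Suc (i + j)) (T j i)" for j i
    have t: "t j i \<in> carrier N" if "i \<le> Suc m" "j \<le> Suc (Suc m)" for i j
      using that Suc.prems(1) by (auto simp: t_def intro: signed_closed[OF N])
    have t_inner: "finsum N (t j) {..m} \<in> carrier N" if "j \<le> Suc (Suc m)" for j
      using that t by (intro N.finsum_closed) auto
    have IH: "finsum N (\<lambda>j. finsum N (t j) {..m}) {..Suc m} = \<zero>\<^bsub>N\<^esub>"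
      unfolding t_def using Suc.prems by (intro Suc.IH) auto
    have cancel: "t (Suc (Suc m)) i = \<ominus>\<^bsub>N\<^esub> t i (Suc m)" if "i \<le> Suc m" for i
    proof -
      have "T (Suc (Suc m)) i = T i (Suc m)"
        using Suc.prems(2)[of i "Suc (Suc m)"] that by simp
      moreover have "T i (Suc m) \<in> carrier N"
        using that Suc.prems(1) by simp
      ultimately show ?thesis
        by (auto simp: t_def signed_def)
    qed
    have "finsum N (\<lambda>j. finsum N (t j) {..Suc m}) {..Suc m}
        = finsum N (\<lambda>j. t j (Suc m) \<oplus>\<^bsub>N\<^esub> finsum N (t j) {..m}) {..Suc m}"
      using t t_inner by (intro N.finsum_cong' N.finsum_Suc) auto
    also have "\<dots> = finsum N (\<lambda>j. t j (Suc m)) {..Suc m}"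
      using t t_inner by (subst N.finsum_addf) (auto simp: IH)
    finally have old: "finsum N (\<lambda>j. finsum N (t j) {..Suc m}) {..Suc m} = \<dots>" .
    have "finsum N (t (Suc (Suc m))) {..Suc m} \<oplus>\<^bsub>N\<^esub> finsum N (\<lambda>j. t j (Suc m)) {..Suc m}
        = finsum N (\<lambda>j. t (Suc (Suc m)) j \<oplus>\<^bsub>N\<^esub> t j (Suc m)) {..Suc m}"
      using t by (intro N.finsum_addf[symmetric]) auto
    also have "\<dots> = finsum N (\<lambda>j. \<zero>\<^bsub>N\<^esub>) {..Suc m}"
      using t by (intro N.finsum_cong') (auto simp: cancel N.l_neg)
    also have "\<dots> = \<zero>\<^bsub>N\<^esub>" by simp
    finally have new: "finsum N (t (Suc (Suc m))) {..Suc m}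
        \<oplus>\<^bsub>N\<^esub> finsum N (\<lambda>j. t j (Suc m)) {..Suc m} = \<zero>\<^bsub>N\<^esub>" .
    have "finsum N (\<lambda>j. finsum N (t j) {..Suc m}) {..Suc (Suc m)}
        = finsum N (t (Suc (Suc m))) {..Suc m} \<oplus>\<^bsub>N\<^esub> finsum N (\<lambda>j. finsum N (t j) {..Suc m}) {..Suc m}"
      using t by (intro N.finsum_Suc) auto
    then have "finsum N (\<lambda>j. finsum N (t j) {..Suc m}) {..Suc (Suc m)} = \<zero>\<^bsub>N\<^esub>"
      using old new by simp
    then show ?case unfolding t_def .
  qed
qed

section \<open>Contracting a chain at a vertex\<close>

text \<open>
  One formula for the three kinds of face of a chain of arrows: dropping the first arrow
  (\<open>i = 0\<close>), dropping the last one (\<open>i = length xs\<close>), and composing two neighbours otherwise. It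
  lets the simplicial identities be checked entry by entry without separating the extreme faces.
\<close>

definition contract :: "nat \<Rightarrow> ('b \<Rightarrow> 'b \<Rightarrow> 'b) \<Rightarrow> 'b list \<Rightarrow> 'b list"
  where "contract i p xs =
    map (\<lambda>l. if Suc l < i then xs ! l else if Suc l = i then p (xs ! i) (xs ! l) else xs ! Suc l)
      [0..<length xs - 1]"

lemma length_contract [simp]: "length (contract i p xs) = length xs - 1"
  by (simp add: contract_def)

lemma nth_contract:
  "l < length xs - 1 \<Longrightarrow> contract i p xs ! l =
     (if Suc l < i then xs ! l else if Suc l = i then p (xs ! i) (xs ! l) else xs ! Suc l)"
  by (simp add: contract_def)

lemma contract_0: "contract 0 p xs = tl xs"
  by (rule nth_equalityI) (simp_all add: nth_contract nth_tl)

lemma contract_last: "contract (length xs) p xs = butlast xs"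
  by (rule nth_equalityI) (auto simp: nth_contract nth_butlast)

lemma contract_merge:
  "\<lbrakk>0 < i; i < length xs\<rbrakk> \<Longrightarrow> contract i p xs = merge_nth i p xs"
  by (rule nth_equalityI)
    (auto simp: nth_contract merge_nth_def nth_append nth_Cons min_def split: nat.splits
      intro!: arg_cong[of _ _ "nth xs"])

lemma length_delete_nth [simp]: "i < length xs \<Longrightarrow> length (delete_nth i xs) = length xs - 1"
  by (simp add: delete_nth_def)

lemma nth_delete_nth:
  "\<lbrakk>i < length xs; l < length xs - 1\<rbrakk> \<Longrightarrow> delete_nth i xs ! l = (if l < i then xs ! l else xs ! Suc l)"
  by (auto simp: delete_nth_def nth_append min_def)

lemma delete_nth_0: "delete_nth 0 xs = tl xs"
  by (simp add: delete_nth_def drop_Suc)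

lemma delete_nth_last: "length xs = Suc n \<Longrightarrow> delete_nth n xs = butlast xs"
  by (simp add: delete_nth_def butlast_conv_take)

lemma delete_nth_delete_nth:
  "\<lbrakk>i < j; j < length xs\<rbrakk> \<Longrightarrow> delete_nth i (delete_nth j xs) = delete_nth (j - 1) (delete_nth i xs)"
  by (rule nth_equalityI) (auto simp: nth_delete_nth)

text \<open>
  The operations may differ between the two sides, since a composition in a graded category
  is labelled by the arrows and objects at which it takes place, and these move when a vertex is deleted.
  Far apart contractions act on disjoint entries; associativity enters only when \<open>j = i + 1\<close>.
\<close>

lemma contract_contract:
  assumes ij: "i < j" "j \<le> length xs"
    and inner: "\<lbrakk>0 < i; Suc i < j\<rbrakk> \<Longrightarrow> p (xs ! i) (xs ! (i - 1)) = p' (xs ! i) (xs ! (i - 1))"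
    and outer: "\<lbrakk>Suc i < j; j < length xs\<rbrakk> \<Longrightarrow> q (xs ! j) (xs ! (j - 1)) = q' (xs ! j) (xs ! (j - 1))"
    and assoc: "\<lbrakk>0 < i; j = Suc i; j < length xs\<rbrakk> \<Longrightarrow>
      p (q (xs ! j) (xs ! i)) (xs ! (i - 1)) = q' (xs ! j) (p' (xs ! i) (xs ! (i - 1)))"
  shows "contract i p (contract j q xs) = contract (j - 1) q' (contract i p' xs)"
proof (rule nth_equalityI)
  fix l
  assume "l < length (contract i p (contract j q xs))"
  then have l: "l < length xs - 1 - 1" by simp
  consider "Suc l < i" | "Suc l = i" "Suc i < j" | "Suc l = i" "Suc i = j"
    | "i < Suc l" "Suc (Suc l) < j" | "i < Suc l" "Suc (Suc l) = j" | "i < Suc l" "j < Suc (Suc l)"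
    using ij by linarith
  then show "contract i p (contract j q xs) ! l = contract (j - 1) q' (contract i p' xs) ! l"
  proof cases
    case 1 then show ?thesis using l ij by (cases j) (auto simp: nth_contract)
  next
    case 2 then show ?thesis using l ij inner by (auto simp: nth_contract)
  next
    case 3 then show ?thesis using l ij assoc by (auto simp: nth_contract)
  next
    case 4 then show ?thesis using l ij by (cases j) (auto simp: nth_contract)
  next
    case 5 then show ?thesis using l ij outer by (auto simp: nth_contract)
  next
    case 6 then show ?thesis using l ij by (cases j) (auto simp: nth_contract)
  qed
qed simp

text \<open>
  How a contraction depends on a single entry. This is what multilinearity of a coface
  requires: the entry is discarded, absorbed into a composition on either side, or moved.
\<close>

lemma contract_list_update:
  assumes "i \<le> length xs" "l < length xs"
  shows "contract i p (xs[l := x]) =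
    (if l = 0 \<and> i = 0 \<or> Suc l = i \<and> i = length xs then contract i p xs
     else if Suc l = i then (contract i p xs)[l := p (xs ! i) x]
     else if l = i then (contract i p xs)[l - 1 := p x (xs ! (i - 1))]
     else (contract i p xs)[(if l < i then l else l - 1) := x])"
  using assms by (intro nth_equalityI) (auto simp: nth_contract nth_list_update)

section \<open>Faces of simplices\<close>

fun face :: "('o, 'm) cat \<Rightarrow> nat \<Rightarrow> ('o, 'm, 'a) gsimplex \<Rightarrow> ('o, 'm, 'a) gsimplex"
  where "face U i (Us, us, As) = (delete_nth i Us, contract i (Comp U) us, delete_nth i As)"

text \<open>
  The labels of the composition are in range exactly at the inner vertices. At \<open>i = 0\<close> and at
  \<open>i = length us\<close> they are junk, but there \<open>contract\<close> only discards an entry.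
\<close>

fun face_args ::
  "('o, 'm, 'a, 'k, 'x) gcat \<Rightarrow> nat \<Rightarrow> ('o, 'm, 'a) gsimplex \<Rightarrow> 'x list \<Rightarrow> 'x list"
  where "face_args a i (Us, us, As) fs =
    contract i (GComp a (us ! i) (us ! (i - 1)) (As ! (i - 1)) (As ! i) (As ! (i + 1))) fs"

fun composite :: "('o, 'm) cat \<Rightarrow> ('o, 'm, 'a) gsimplex \<Rightarrow> 'm"
  where "composite U (Us, us, As) = total U Us us"

text \<open>
  What the \<open>i\<close>th coface does to the value of a cochain at the \<open>i\<close>th face: an extreme face leaves
  out an argument, which is then composed with the value.
\<close>

fun compose_end ::
  "('o, 'm) cat \<Rightarrow> ('o, 'm, 'a, 'k, 'x) gcat \<Rightarrow> nat \<Rightarrow> ('o, 'm, 'a) gsimplex \<Rightarrow> 'x list \<Rightarrow> 'x \<Rightarrow> 'x"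
  where "compose_end U a i (Us, us, As) fs x =
    (if i = 0 then
       GComp a (composite U (face U 0 (Us, us, As))) (us ! 0) (As ! 0) (As ! 1) (As ! length us)
         x (fs ! 0)
     else if i = length us then
       GComp a (us ! (i - 1)) (composite U (face U i (Us, us, As))) (As ! 0) (As ! (i - 1)) (As ! i)
         (fs ! (i - 1)) x
     else x)"

lemma gsimplices_iff:
  "(Us, us, As) \<in> gsimplices U a n \<longleftrightarrow>
     length Us = Suc n \<and> length us = n \<and> length As = Suc n \<and>
     (\<forall>i\<le>n. Us ! i \<in> Obj U \<and> As ! i \<in> Fib a (Us ! i)) \<and>
     (\<forall>i<n. us ! i \<in> Arr U \<and> Dom U (us ! i) = Us ! i \<and> Cod U (us ! i) = Us ! Suc i)"
  by (auto simp: gsimplices_def nerve_def subset_eq all_set_conv_all_nth less_Suc_eq_le)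

lemma face_face:
  assumes "category U" "\<sigma> \<in> gsimplices U a (Suc n)" "i < j" "j \<le> Suc n"
  shows "face U i (face U j \<sigma>) = face U (j - 1) (face U i \<sigma>)"
proof -
  interpret category U by fact
  obtain Us us As where \<sigma>: "\<sigma> = (Us, us, As)" by (cases \<sigma>)
  have "contract i (Comp U) (contract j (Comp U) us) = contract (j - 1) (Comp U) (contract i (Comp U) us)"
    using assms(2-4) unfolding \<sigma> gsimplices_iff
    by (intro contract_contract) (auto intro!: Comp_assoc[symmetric])
  then show ?thesis
    using assms(2-4) by (simp add: \<sigma> gsimplices_iff delete_nth_delete_nth)
qed

lemma face_in_gsimplices:
  assumes "category U" "\<sigma> \<in> gsimplices U a (Suc n)" "i \<le> Suc n"
  shows "face U i \<sigma> \<in> gsimplices U a n"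
proof -
  interpret category U by fact
  obtain Us us As where \<sigma>: "\<sigma> = (Us, us, As)" by (cases \<sigma>)
  show ?thesis
    using assms(2,3) unfolding \<sigma> face.simps gsimplices_iff
    by (auto simp: nth_contract nth_delete_nth Comp_in Dom_Comp Cod_Comp)
qed

context category
begin

lemma composite_last:
  assumes "(Us, us, As) \<in> gsimplices C a (Suc n)"
  shows "composite C (Us, us, As) = Comp C (us ! n) (composite C (face C (Suc n) (Us, us, As)))"
proof -
  have len: "length us = Suc n" "length Us = Suc (Suc n)"
    using assms by (auto simp: gsimplices_iff)
  then have "us = butlast us @ [us ! n]" "hd (butlast Us) = hd Us"
    using append_butlast_last_id[of us]
    by (auto simp: last_conv_nth hd_conv_nth nth_butlast simp flip: length_greater_0_conv)
  moreover have "contract (Suc n) (Comp C) us = butlast us" "delete_nth (Suc n) Us = butlast Us"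
    using len contract_last[of us "Comp C"] delete_nth_last by auto
  ultimately show ?thesis
    by (simp add: total_def) (metis fold_append fold_simps o_apply)
qed

lemma composite_in:
  assumes "\<sigma> \<in> gsimplices C a n"
  shows "composite C \<sigma> \<in> Arr C \<and> Dom C (composite C \<sigma>) = fst \<sigma> ! 0 \<and> Cod C (composite C \<sigma>) = fst \<sigma> ! n"
  using assms
proof (induction n arbitrary: \<sigma>)
  case 0
  then show ?case
    by (cases \<sigma>) (auto simp: gsimplices_iff total_def hd_conv_nth Ide_in Dom_Ide Cod_Ide
        simp flip: length_greater_0_conv)
next
  case (Suc n)
  obtain Us us As where \<sigma>: "\<sigma> = (Us, us, As)" by (cases \<sigma>)
  let ?\<tau> = "face C (Suc n) \<sigma>"
  have "?\<tau> \<in> gsimplices C a n"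
    using Suc.prems by (intro face_in_gsimplices category_axioms) auto
  from Suc.IH[OF this] Suc.prems show ?case
    unfolding \<sigma> composite_last[OF Suc.prems[unfolded \<sigma>]]
    by (auto simp: gsimplices_iff nth_delete_nth Comp_in Dom_Comp Cod_Comp)
qed

text \<open>
  The composite is built by adding arrows at the end, so splitting off the first arrow needs
  an induction that peels off last arrows; the first and the last face commute.
\<close>

lemma composite_first:
  assumes "(Us, us, As) \<in> gsimplices C a (Suc n)"
  shows "composite C (Us, us, As) = Comp C (composite C (face C 0 (Us, us, As))) (us ! 0)"
  using assms
proof (induction n arbitrary: Us us As)
  case 0
  obtain U0 U1 u where "Us = [U0, U1]" "us = [u]"
    using 0 by (auto simp: gsimplices_iff length_Suc_conv)
  then show ?case
    using 0 Comp_Ide_left[of u] Comp_Ide_right[of u]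
    by (auto simp: gsimplices_iff total_def contract_def delete_nth_def)
next
  case (Suc n)
  let ?\<sigma> = "(Us, us, As)"
  let ?l = "face C (Suc (Suc n)) ?\<sigma>" and ?f = "face C 0 ?\<sigma>"
  obtain Us' us' As' where l: "?l = (Us', us', As')" by (cases ?l)
  obtain Us'' us'' As'' where f: "?f = (Us'', us'', As'')" by (cases ?f)
  have l_in: "?l \<in> gsimplices C a (Suc n)" and f_in: "?f \<in> gsimplices C a (Suc n)"
    by (intro face_in_gsimplices category_axioms Suc.prems; simp)+
  have m_in: "face C 0 ?l \<in> gsimplices C a n"
    by (intro face_in_gsimplices category_axioms l_in; simp)
  have m: "face C 0 ?l = face C (Suc n) ?f"
    using face_face[OF category_axioms Suc.prems, of 0 "Suc (Suc n)"] by simp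
  have us: "us' ! 0 = us ! 0" "us'' ! n = us ! Suc n"
    using l f Suc.prems by (auto simp: nth_contract gsimplices_iff)
  have Us: "fst (face C 0 ?l) ! 0 = Us ! 1" "fst (face C 0 ?l) ! n = Us ! Suc n"
    using Suc.prems by (auto simp: nth_delete_nth gsimplices_iff)
  have "composite C ?\<sigma> = Comp C (us ! Suc n) (composite C ?l)"
    by (rule composite_last[OF Suc.prems])
  also have "composite C ?l = Comp C (composite C (face C 0 ?l)) (us ! 0)"
    using Suc.IH[OF l_in[unfolded l]] us by (simp only: l)
  also have "Comp C (us ! Suc n) \<dots> = Comp C (Comp C (us ! Suc n) (composite C (face C 0 ?l))) (us ! 0)"
    using composite_in[OF m_in] Suc.prems Us by (intro Comp_assoc) (auto simp: gsimplices_iff)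
  also have "Comp C (us ! Suc n) (composite C (face C 0 ?l)) = composite C ?f"
    using composite_last[OF f_in[unfolded f]] us by (simp only: m f)
  finally show ?case .
qed

text \<open>
  Again the last arrow is peeled off. Only when it takes part in the contraction is
  associativity used; otherwise the two faces commute.
\<close>

lemma composite_mid:
  assumes "\<sigma> \<in> gsimplices C a (Suc n)" "0 < i" "i \<le> n"
  shows "composite C (face C i \<sigma>) = composite C \<sigma>"
  using assms
proof (induction n arbitrary: \<sigma>)
  case (Suc n)
  obtain Us us As where \<sigma>: "\<sigma> = (Us, us, As)" by (cases \<sigma>)
  let ?l = "face C (Suc (Suc n)) \<sigma>" and ?f = "face C i \<sigma>"
  obtain Us' us' As' where l: "?l = (Us', us', As')" by (cases ?l)
  obtain Us'' us'' As'' where f: "?f = (Us'', us'', As'')" by (cases ?f)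
  have l_in: "?l \<in> gsimplices C a (Suc n)" and f_in: "?f \<in> gsimplices C a (Suc n)"
    using Suc.prems by (intro face_in_gsimplices category_axioms Suc.prems; simp)+
  have m: "face C i ?l = face C (Suc n) ?f"
    using face_face[OF category_axioms Suc.prems(1), of i "Suc (Suc n)"] Suc.prems by simp
  have m_in: "face C i ?l \<in> gsimplices C a n"
    using Suc.prems by (intro face_in_gsimplices category_axioms l_in; simp)
  have total: "composite C \<sigma> = Comp C (us ! Suc n) (composite C ?l)"
    using composite_last Suc.prems(1) unfolding \<sigma> by blast
  have total_f: "composite C ?f = Comp C (us'' ! n) (composite C (face C i ?l))"
    using composite_last[OF f_in[unfolded f]] by (simp only: m f)
  show ?case
  proof (cases "i = Suc n")
    case True
    have us: "us'' ! n = Comp C (us ! Suc n) (us ! n)" "us' ! n = us ! n"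
      using l f Suc.prems True by (auto simp: \<sigma> nth_contract gsimplices_iff)
    have Us: "fst (face C (Suc n) ?l) ! n = Us ! n"
      using Suc.prems True by (auto simp: \<sigma> nth_delete_nth gsimplices_iff)
    have "composite C ?f = Comp C (Comp C (us ! Suc n) (us ! n)) (composite C (face C (Suc n) ?l))"
      using total_f us True by simp
    also have "\<dots> = Comp C (us ! Suc n) (Comp C (us ! n) (composite C (face C (Suc n) ?l)))"
      using composite_in[OF m_in] Suc.prems(1) Us True
      by (intro Comp_assoc[symmetric]) (auto simp: \<sigma> gsimplices_iff)
    also have "Comp C (us ! n) (composite C (face C (Suc n) ?l)) = composite C ?l"
      using composite_last[OF l_in[unfolded l]] us by (simp only: l)
    finally show ?thesis using total by simp
  next
    case False
    then have "us'' ! n = us ! Suc n"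
      using f Suc.prems by (auto simp: \<sigma> nth_contract gsimplices_iff)
    then show ?thesis
      using total_f total Suc.IH[OF l_in] Suc.prems False by simp
  qed
qed simp

end

section \<open>The cofaces of a Hochschild cochain\<close>

abbreviation args ::
  "('o, 'm, 'a, 'k, 'x) gcat \<Rightarrow> ('o, 'm, 'a) gsimplex \<Rightarrow> 'x list set"
  where "args a \<sigma> \<equiv> listset (map carrier (factors a \<sigma>))"

abbreviation cochains ::
  "('k, 'r) ring_scheme \<Rightarrow> ('o, 'm) cat \<Rightarrow> ('o, 'm, 'a, 'k, 'x) gcat \<Rightarrow> ('o, 'm, 'a) gsimplex \<Rightarrow>
   ('k, 'x list \<Rightarrow> 'x) module"
  where "cochains k U a \<sigma> \<equiv> multilinear_module k (factors a \<sigma>) (target U a \<sigma>)"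

lemma length_factors [simp]: "length (factors a (Us, us, As)) = length us"
  by simp

lemma nth_factors [simp]:
  "i < length us \<Longrightarrow> factors a (Us, us, As) ! i = GHom a (us ! i) (As ! i) (As ! Suc i)"
  by simp

lemma args_iff:
  "fs \<in> args a (Us, us, As) \<longleftrightarrow>
     length fs = length us \<and> (\<forall>i<length us. fs ! i \<in> carrier (GHom a (us ! i) (As ! i) (As ! Suc i)))"
  by (auto simp: mem_listset_iff)

lemma target_eq:
  "(Us, us, As) \<in> gsimplices U a n \<Longrightarrow>
     target U a (Us, us, As) = GHom a (composite U (Us, us, As)) (As ! 0) (As ! n)"
  by (auto simp: gsimplices_iff hd_conv_nth last_conv_nth simp flip: length_greater_0_conv)

declare factors.simps [simp del] target.simps [simp del] composite.simps [simp del]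

context graded_category
begin

lemmas face_in = face_in_gsimplices[OF category_axioms]

lemma GComp_in:
  "\<lbrakk>u \<in> Arr U; u' \<in> Arr U; Cod U u = Dom U u';
    A \<in> Fib a (Dom U u); A' \<in> Fib a (Cod U u); A'' \<in> Fib a (Cod U u');
    f \<in> carrier (GHom a u A A'); g \<in> carrier (GHom a u' A' A'')\<rbrakk>
   \<Longrightarrow> GComp a u' u A A' A'' g f \<in> carrier (GHom a (Comp U u' u) A A'')"
  by (rule mod_hom_closed[OF GComp_linear_right])

lemma module_target:
  assumes "\<sigma> \<in> gsimplices U a n"
  shows "module k (target U a \<sigma>)"
proof -
  obtain Us us As where \<sigma>: "\<sigma> = (Us, us, As)" by (cases \<sigma>)
  show ?thesis
    using assms composite_in[OF assms]
    by (auto simp: \<sigma> target_eq[OF assms[unfolded \<sigma>]] gsimplices_iff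
        intro!: GHom_module)
qed

lemma module_factors:
  assumes "\<sigma> \<in> gsimplices U a n" "i < length (factors a \<sigma>)"
  shows "module k (factors a \<sigma> ! i)"
  using assms by (cases \<sigma>) (auto simp: gsimplices_iff intro!: GHom_module)

lemma module_cochains:
  "\<sigma> \<in> gsimplices U a n \<Longrightarrow> module k (cochains k U a \<sigma>)"
  by (intro module_multilinear_module module_target module_factors)

lemma face_args_in:
  assumes "\<sigma> \<in> gsimplices U a (Suc n)" "i \<le> Suc n" "fs \<in> args a \<sigma>"
  shows "face_args a i \<sigma> fs \<in> args a (face U i \<sigma>)"
proof -
  obtain Us us As where \<sigma>: "\<sigma> = (Us, us, As)" by (cases \<sigma>)
  show ?thesis
    using assms unfolding \<sigma> face.simps face_args.simps gsimplices_iff args_iff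
    by (auto simp: nth_contract nth_delete_nth intro!: GComp_in)
qed

lemma face_args_face:
  assumes "\<sigma> \<in> gsimplices U a (Suc n)" "fs \<in> args a \<sigma>" "i < j" "j \<le> Suc n"
  shows "face_args a i (face U j \<sigma>) (face_args a j \<sigma> fs)
       = face_args a (j - 1) (face U i \<sigma>) (face_args a i \<sigma> fs)"
proof -
  obtain Us us As where \<sigma>: "\<sigma> = (Us, us, As)" by (cases \<sigma>)
  note h = assms[unfolded \<sigma> gsimplices_iff args_iff]
  show ?thesis
    unfolding \<sigma> face.simps face_args.simps
  proof (intro contract_contract)
    assume "0 < i" "Suc i < j"
    with h show "GComp a (contract j (Comp U) us ! i) (contract j (Comp U) us ! (i - 1))
        (delete_nth j As ! (i - 1)) (delete_nth j As ! i) (delete_nth j As ! (i + 1)) (fs ! i) (fs ! (i - 1))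
      = GComp a (us ! i) (us ! (i - 1)) (As ! (i - 1)) (As ! i) (As ! (i + 1)) (fs ! i) (fs ! (i - 1))"
      by (auto simp: nth_contract nth_delete_nth)
  next
    assume ij: "Suc i < j" "j < length fs"
    then obtain m where "j = Suc (Suc m)"
      using less_imp_Suc_add[of "Suc i" j] by auto
    with ij h show "GComp a (us ! j) (us ! (j - 1)) (As ! (j - 1)) (As ! j) (As ! (j + 1)) (fs ! j) (fs ! (j - 1))
      = GComp a (contract i (Comp U) us ! (j - 1)) (contract i (Comp U) us ! (j - 1 - 1))
          (delete_nth i As ! (j - 1 - 1)) (delete_nth i As ! (j - 1)) (delete_nth i As ! (j - 1 + 1))
          (fs ! j) (fs ! (j - 1))"
      by (auto simp: nth_contract nth_delete_nth)
  next
    assume ij: "0 < i" "j = Suc i" "j < length fs"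
    then obtain m where "i = Suc m"
      using gr0_implies_Suc by blast
    with ij h show "GComp a (contract j (Comp U) us ! i) (contract j (Comp U) us ! (i - 1))
        (delete_nth j As ! (i - 1)) (delete_nth j As ! i) (delete_nth j As ! (i + 1))
        (GComp a (us ! j) (us ! (j - 1)) (As ! (j - 1)) (As ! j) (As ! (j + 1)) (fs ! j) (fs ! i))
        (fs ! (i - 1))
      = GComp a (contract i (Comp U) us ! (j - 1)) (contract i (Comp U) us ! (j - 1 - 1))
          (delete_nth i As ! (j - 1 - 1)) (delete_nth i As ! (j - 1)) (delete_nth i As ! (j - 1 + 1))
          (fs ! j)
          (GComp a (us ! i) (us ! (i - 1)) (As ! (i - 1)) (As ! i) (As ! (i + 1)) (fs ! i) (fs ! (i - 1)))"
      by (auto simp: nth_contract nth_delete_nth intro!: GComp_assoc[symmetric])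
  qed (use h in auto)
qed

lemma compose_end_linear:
  assumes "\<sigma> \<in> gsimplices U a (Suc n)" "fs \<in> args a \<sigma>" "i \<le> Suc n"
  shows "compose_end U a i \<sigma> fs \<in> mod_hom k (target U a (face U i \<sigma>)) (target U a \<sigma>)"
proof -
  obtain Us us As where \<sigma>: "\<sigma> = (Us, us, As)" by (cases \<sigma>)
  note s = assms(1)[unfolded \<sigma>]
  let ?\<tau> = "(delete_nth i Us, contract i (Comp U) us, delete_nth i As)"
  have \<tau>: "?\<tau> \<in> gsimplices U a n"
    using face_in[OF s assms(3)] by simp
  note tgt = target_eq[OF s] target_eq[OF \<tau>]
  note cmp = composite_in[OF \<tau>, simplified fst_conv]
  consider "i = 0" | "i = Suc n" | "0 < i" "i \<le> n" using assms(3) by linarith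
  then show ?thesis
  proof cases
    case 1
    have "compose_end U a i \<sigma> fs = (\<lambda>x. GComp a (composite U ?\<tau>) (us ! 0) (As ! 0) (As ! 1) (As ! Suc n) x (fs ! 0))"
      using s 1 by (auto simp: \<sigma> gsimplices_iff)
    moreover have "\<dots> \<in> mod_hom k (GHom a (composite U ?\<tau>) (As ! 1) (As ! Suc n))
        (GHom a (Comp U (composite U ?\<tau>) (us ! 0)) (As ! 0) (As ! Suc n))"
      using s cmp 1 assms(2)
      by (intro GComp_linear_left) (auto simp: \<sigma> gsimplices_iff args_iff nth_delete_nth)
    ultimately show ?thesis
      using s 1 composite_first[OF s] unfolding \<sigma> face.simps tgt
      by (simp add: gsimplices_iff nth_delete_nth)
  next
    case 2
    have "compose_end U a i \<sigma> fs = GComp a (us ! n) (composite U ?\<tau>) (As ! 0) (As ! n) (As ! Suc n) (fs ! n)"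
      using s 2 by (auto simp: \<sigma> gsimplices_iff)
    moreover have "\<dots> \<in> mod_hom k (GHom a (composite U ?\<tau>) (As ! 0) (As ! n))
        (GHom a (Comp U (us ! n) (composite U ?\<tau>)) (As ! 0) (As ! Suc n))"
      using s cmp 2 assms(2)
      by (intro GComp_linear_right) (auto simp: \<sigma> gsimplices_iff args_iff nth_delete_nth)
    ultimately show ?thesis
      using s 2 composite_last[OF s] unfolding \<sigma> face.simps tgt
      by (simp add: gsimplices_iff nth_delete_nth)
  next
    case 3
    have "compose_end U a i \<sigma> fs = (\<lambda>x. x)"
      using s 3 by (auto simp: \<sigma> gsimplices_iff)
    moreover have "target U a (face U i \<sigma>) = target U a \<sigma>"
      using s 3 composite_mid[OF s, of i] unfolding \<sigma> face.simps tgt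
      by (simp add: gsimplices_iff nth_delete_nth)
    ultimately show ?thesis by (simp add: mod_hom_id)
  qed
qed


text \<open>
  The cosimplicial identity on values. Associativity of the graded composition is needed when
  both ends are composed, or two arguments at the same end (one after the other on one side, composed
  first on the other). In the remaining cases at most one end is involved, and the
  composite labelling the value is unchanged by an inner face.
\<close>

lemma compose_end_compose_end:
  assumes "\<sigma> \<in> gsimplices U a (Suc (Suc n))" "fs \<in> args a \<sigma>" "i < j" "j \<le> Suc (Suc n)"
    and "x \<in> carrier (target U a (face U i (face U j \<sigma>)))"
  shows "compose_end U a j \<sigma> fs (compose_end U a i (face U j \<sigma>) (face_args a j \<sigma> fs) x)
       = compose_end U a i \<sigma> fs (compose_end U a (j - 1) (face U i \<sigma>) (face_args a i \<sigma> fs) x)"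
proof -
  obtain Us us As where \<sigma>: "\<sigma> = (Us, us, As)" by (cases \<sigma>)
  note s = assms(1)[unfolded \<sigma>]
  have dims: "length us = Suc (Suc n)" "length As = Suc (Suc (Suc n))" "length fs = Suc (Suc n)"
    using s assms(2) by (auto simp: \<sigma> gsimplices_iff args_iff)
  let ?\<sigma> = "(Us, us, As)"
  have face1: "face U l ?\<sigma> \<in> gsimplices U a (Suc n)" if "l \<le> Suc (Suc n)" for l
    using face_in[OF s that] .
  have face2: "face U l (face U l' ?\<sigma>) \<in> gsimplices U a n" if "l \<le> Suc n" "l' \<le> Suc (Suc n)" for l l'
    using face_in[OF face1[OF that(2)] that(1)] .
  have ff: "face U l (face U l' ?\<sigma>) = face U (l' - 1) (face U l ?\<sigma>)" if "l < l'" "l' \<le> Suc (Suc n)" for l l'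
    using face_face[OF category_axioms s that] .
  let ?c = "\<lambda>\<tau>. composite U \<tau>"
  let ?\<rho> = "face U i (face U j ?\<sigma>)"
  have \<rho>: "?\<rho> \<in> gsimplices U a n" using face2 assms(3,4) by simp
  have x: "x \<in> carrier (GHom a (?c ?\<rho>) (delete_nth i (delete_nth j As) ! 0) (delete_nth i (delete_nth j As) ! n))"
    using assms(5) target_eq[OF \<rho>[unfolded face.simps]] unfolding \<sigma> face.simps by simp
  have c\<rho>: "?c ?\<rho> \<in> Arr U" "Dom U (?c ?\<rho>) = delete_nth i (delete_nth j Us) ! 0"
     "Cod U (?c ?\<rho>) = delete_nth i (delete_nth j Us) ! n"
    using composite_in[OF \<rho>] by auto
  have first: "?c (face U l ?\<sigma>) = Comp U (?c (face U 0 (face U l ?\<sigma>))) (contract l (Comp U) us ! 0)"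
    if "l \<le> Suc (Suc n)" for l
    using composite_first[of "delete_nth l Us" "contract l (Comp U) us" "delete_nth l As"] face1[OF that] by simp
  have last: "?c (face U l ?\<sigma>) = Comp U (contract l (Comp U) us ! n) (?c (face U (Suc n) (face U l ?\<sigma>)))"
    if "l \<le> Suc (Suc n)" for l
    using composite_last[of "delete_nth l Us" "contract l (Comp U) us" "delete_nth l As"] face1[OF that] by simp
  have mid: "?c (face U l' (face U l ?\<sigma>)) = ?c (face U l ?\<sigma>)" if "l \<le> Suc (Suc n)" "0 < l'" "l' \<le> n" for l l'
    using composite_mid[OF face1[OF that(1)] that(2,3)] .
  note simps = dims nth_contract nth_delete_nth
  consider "i = 0" "j = Suc (Suc n)" | "i = 0" "j = 1" | "i = 0" "1 < j" "j < Suc (Suc n)"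
    | "0 < i" "i = Suc n" "j = Suc (Suc n)" | "0 < i" "i \<le> n" "j = Suc (Suc n)"
    | "0 < i" "j < Suc (Suc n)"
    using assms(3,4) by linarith
  then show ?thesis
  proof cases
    case 1
    have "compose_end U a j ?\<sigma> fs (compose_end U a i (face U j ?\<sigma>) (face_args a j ?\<sigma> fs) x) =
      GComp a (us ! Suc n) (Comp U (?c ?\<rho>) (us ! 0)) (As ! 0) (As ! Suc n) (As ! Suc (Suc n)) (fs ! Suc n)
        (GComp a (?c ?\<rho>) (us ! 0) (As ! 0) (As ! 1) (As ! Suc n) x (fs ! 0))"
      using 1 first[of "Suc (Suc n)"] by (simp add: simps)
    also have "\<dots> = GComp a (Comp U (us ! Suc n) (?c ?\<rho>)) (us ! 0) (As ! 0) (As ! 1) (As ! Suc (Suc n))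
        (GComp a (us ! Suc n) (?c ?\<rho>) (As ! 1) (As ! Suc n) (As ! Suc (Suc n)) (fs ! Suc n) x) (fs ! 0)"
      using 1 s c\<rho> x assms(2)
      by (intro GComp_assoc) (auto simp: \<sigma> gsimplices_iff args_iff simps)
    also have "\<dots> = compose_end U a i ?\<sigma> fs (compose_end U a (j - 1) (face U i ?\<sigma>) (face_args a i ?\<sigma> fs) x)"
      using 1 last[of 0] ff[of i j] by (simp add: simps)
    finally show ?thesis by (simp only: \<sigma>)
  next
    case 2
    have "compose_end U a j ?\<sigma> fs (compose_end U a i (face U j ?\<sigma>) (face_args a j ?\<sigma> fs) x) =
      GComp a (?c ?\<rho>) (Comp U (us ! 1) (us ! 0)) (As ! 0) (As ! 2) (As ! Suc (Suc n)) x
        (GComp a (us ! 1) (us ! 0) (As ! 0) (As ! 1) (As ! 2) (fs ! 1) (fs ! 0))"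
      using 2 by (simp add: simps numeral_2_eq_2)
    also have "\<dots> = GComp a (Comp U (?c ?\<rho>) (us ! 1)) (us ! 0) (As ! 0) (As ! 1) (As ! Suc (Suc n))
        (GComp a (?c ?\<rho>) (us ! 1) (As ! 1) (As ! 2) (As ! Suc (Suc n)) x (fs ! 1)) (fs ! 0)"
      using 2 s c\<rho> x assms(2)
      by (intro GComp_assoc) (auto simp: \<sigma> gsimplices_iff args_iff simps numeral_2_eq_2)
    also have "\<dots> = compose_end U a i ?\<sigma> fs (compose_end U a (j - 1) (face U i ?\<sigma>) (face_args a i ?\<sigma> fs) x)"
      using 2 first[of 0] ff[of i j] by (simp add: simps numeral_2_eq_2)
    finally show ?thesis by (simp only: \<sigma>)
  next
    case 3
    then show ?thesis
      using mid[of 0 "j - 1"] ff[of 0 j] by (auto simp: \<sigma> simps)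
  next
    case 4
    have "compose_end U a j ?\<sigma> fs (compose_end U a i (face U j ?\<sigma>) (face_args a j ?\<sigma> fs) x) =
      GComp a (us ! Suc n) (Comp U (us ! n) (?c ?\<rho>)) (As ! 0) (As ! Suc n) (As ! Suc (Suc n)) (fs ! Suc n)
        (GComp a (us ! n) (?c ?\<rho>) (As ! 0) (As ! n) (As ! Suc n) (fs ! n) x)"
      using 4 last[of "Suc (Suc n)"] by (simp add: simps)
    also have "\<dots> = GComp a (Comp U (us ! Suc n) (us ! n)) (?c ?\<rho>) (As ! 0) (As ! n) (As ! Suc (Suc n))
        (GComp a (us ! Suc n) (us ! n) (As ! n) (As ! Suc n) (As ! Suc (Suc n)) (fs ! Suc n) (fs ! n)) x"
      using 4 s c\<rho> x assms(2)
      by (intro GComp_assoc) (auto simp: \<sigma> gsimplices_iff args_iff simps)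
    also have "\<dots> = compose_end U a i ?\<sigma> fs (compose_end U a (j - 1) (face U i ?\<sigma>) (face_args a i ?\<sigma> fs) x)"
      using 4 ff[of i j] by (simp add: simps)
    finally show ?thesis by (simp only: \<sigma>)
  next
    case 5
    then show ?thesis
      using mid[of "Suc (Suc n)" i] ff[of i "Suc (Suc n)"] by (simp add: \<sigma> simps)
  next
    case 6
    then show ?thesis
      using assms(3,4) by (auto simp: \<sigma> simps)
  qed
qed


text \<open>
  Either the varying argument is the one composed with the value, and linearity of the
  composition suffices; or it enters the cochain through one entry of the contracted list, linearly,
  and the resulting value is transformed by a fixed linear map.
\<close>

lemma coface_multilinear:
  assumes \<sigma>: "\<sigma> \<in> gsimplices U a (Suc n)" and i: "i \<le> Suc n"
    and f: "f \<in> carrier (cochains k U a (face U i \<sigma>))"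
    and fs: "fs \<in> args a \<sigma>" and l: "l < Suc n"
  shows "(\<lambda>x. compose_end U a i \<sigma> (fs[l := x]) (f (face_args a i \<sigma> (fs[l := x]))))
      \<in> mod_hom k (factors a \<sigma> ! l) (target U a \<sigma>)"
proof -
  obtain Us us As where \<sigma>_eq: "\<sigma> = (Us, us, As)" by (cases \<sigma>)
  let ?\<tau> = "(delete_nth i Us, contract i (Comp U) us, delete_nth i As)"
  note s = \<sigma>[unfolded \<sigma>_eq]
  have \<tau>: "?\<tau> \<in> gsimplices U a n"
    using face_in[OF s i] by simp
  note tgt = target_eq[OF s] target_eq[OF \<tau>]
  note cmp = composite_in[OF \<tau>, simplified fst_conv]
  have dims: "length us = Suc n" "length As = Suc (Suc n)" "length fs = Suc n"
    using s fs by (auto simp: \<sigma>_eq gsimplices_iff args_iff)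
  have args: "face_args a i \<sigma> fs \<in> args a ?\<tau>"
    using face_args_in[OF \<sigma> i fs] by (simp add: \<sigma>_eq)
  have f_args: "f (face_args a i \<sigma> fs) \<in> carrier (target U a ?\<tau>)"
    using f args by (auto simp: multilinear_carrier \<sigma>_eq)
  consider "i = 0" "l = 0" | "i = Suc n" "l = n" | "\<not> (i = 0 \<and> l = 0)" "\<not> (i = Suc n \<and> l = n)"
    by blast
  then show ?thesis
  proof cases
    case 1
    have "GComp a (composite U ?\<tau>) (us ! 0) (As ! 0) (As ! 1) (As ! Suc n) (f (face_args a i \<sigma> fs))
        \<in> mod_hom k (GHom a (us ! 0) (As ! 0) (As ! 1))
            (GHom a (Comp U (composite U ?\<tau>) (us ! 0)) (As ! 0) (As ! Suc n))"
      using s 1 cmp f_args[unfolded tgt(2)]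
      by (intro GComp_linear_right)
        (auto simp: gsimplices_iff nth_delete_nth)
    moreover have "Comp U (composite U ?\<tau>) (us ! 0) = composite U (Us, us, As)"
      using composite_first[OF s] 1 by simp
    ultimately show ?thesis
      using 1 contract_list_update[of 0 fs 0]
      by (simp add: \<sigma>_eq tgt dims)
  next
    case 2
    have "(\<lambda>g. GComp a (us ! n) (composite U ?\<tau>) (As ! 0) (As ! n) (As ! Suc n) g (f (face_args a i \<sigma> fs)))
        \<in> mod_hom k (GHom a (us ! n) (As ! n) (As ! Suc n))
            (GHom a (Comp U (us ! n) (composite U ?\<tau>)) (As ! 0) (As ! Suc n))"
      using s 2 cmp f_args[unfolded tgt(2)]
      by (intro GComp_linear_left)
        (auto simp: gsimplices_iff nth_delete_nth)
    moreover have "Comp U (us ! n) (composite U ?\<tau>) = composite U (Us, us, As)"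
      using composite_last[OF s] 2 by simp
    ultimately show ?thesis
      using 2 contract_list_update[of "Suc n" fs n]
      by (simp add: \<sigma>_eq tgt dims)
  next
    case 3
    define l' where "l' = (if l < i then l else l - 1)"
    define h where "h x =
      (if Suc l = i then GComp a (us ! i) (us ! l) (As ! l) (As ! i) (As ! (i + 1)) (fs ! i) x
       else if l = i then GComp a (us ! i) (us ! (i - 1)) (As ! (i - 1)) (As ! i) (As ! (i + 1)) x (fs ! (i - 1))
       else x)" for x
    have outer_upd: "compose_end U a i \<sigma> (fs[l := x]) = compose_end U a i \<sigma> fs" for x
      using 3 dims l by (auto simp: \<sigma>_eq fun_eq_iff nth_list_update)
    have args_upd: "face_args a i \<sigma> (fs[l := x]) = (face_args a i \<sigma> fs)[l' := h x]" for x
      using 3 dims l i by (auto simp: \<sigma>_eq contract_list_update h_def l'_def)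
    have h: "h \<in> mod_hom k (factors a \<sigma> ! l) (factors a ?\<tau> ! l')"
    proof -
      consider "Suc l = i" | "l = i" "0 < i" | "Suc l < i" | "i < l"
        using 3 by linarith
      then show ?thesis
      proof cases
        case a: 1
        have "h = GComp a (us ! i) (us ! l) (As ! l) (As ! i) (As ! (i + 1)) (fs ! i)"
          using a by (simp add: h_def fun_eq_iff)
        moreover have "\<dots> \<in> mod_hom k (GHom a (us ! l) (As ! l) (As ! i))
            (GHom a (Comp U (us ! i) (us ! l)) (As ! l) (As ! (i + 1)))"
          using a 3 s l fs i dims
          by (intro GComp_linear_right) (auto simp: \<sigma>_eq gsimplices_iff args_iff)
        moreover have "factors a \<sigma> ! l = GHom a (us ! l) (As ! l) (As ! i)"
          using a l dims by (simp add: \<sigma>_eq)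
        moreover have "factors a ?\<tau> ! l' = GHom a (Comp U (us ! i) (us ! l)) (As ! l) (As ! (i + 1))"
          using a l dims 3 i by (auto simp: l'_def nth_contract nth_delete_nth)
        ultimately show ?thesis by simp
      next
        case a: 2
        have "h = (\<lambda>x. GComp a (us ! i) (us ! (i - 1)) (As ! (i - 1)) (As ! i) (As ! (i + 1)) x (fs ! (i - 1)))"
          using a by (simp add: h_def fun_eq_iff)
        moreover have "\<dots> \<in> mod_hom k (GHom a (us ! i) (As ! i) (As ! (i + 1)))
            (GHom a (Comp U (us ! i) (us ! (i - 1))) (As ! (i - 1)) (As ! (i + 1)))"
          using a 3 s l fs i dims
          by (cases i; intro GComp_linear_left) (auto simp: \<sigma>_eq gsimplices_iff args_iff)
        moreover have "factors a \<sigma> ! l = GHom a (us ! i) (As ! i) (As ! (i + 1))"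
          using a l dims by (simp add: \<sigma>_eq)
        moreover have "factors a ?\<tau> ! l' = GHom a (Comp U (us ! i) (us ! (i - 1))) (As ! (i - 1)) (As ! (i + 1))"
          using a l dims 3 i by (auto simp: l'_def nth_contract nth_delete_nth)
        ultimately show ?thesis by simp
      next
        case a: 3
        then have "h = (\<lambda>x. x)" "factors a ?\<tau> ! l' = factors a \<sigma> ! l"
          using l dims i by (auto simp: h_def l'_def \<sigma>_eq nth_contract nth_delete_nth)
        then show ?thesis by (simp add: mod_hom_id)
      next
        case a: 4
        then have "h = (\<lambda>x. x)" "factors a ?\<tau> ! l' = factors a \<sigma> ! l"
          using l dims i by (auto simp: h_def l'_def \<sigma>_eq nth_contract nth_delete_nth)
        then show ?thesis by (simp add: mod_hom_id)
      qed
    qed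
    have "l' < length (factors a ?\<tau>)"
      using 3 l i dims by (auto simp: l'_def)
    then have "(\<lambda>y. f ((face_args a i \<sigma> fs)[l' := y])) \<in> mod_hom k (factors a ?\<tau> ! l') (target U a ?\<tau>)"
      using f args by (auto simp: multilinear_carrier \<sigma>_eq)
    from mod_hom_comp[OF mod_hom_comp[OF h this]] compose_end_linear[OF \<sigma> fs i]
    show ?thesis
      unfolding outer_upd args_upd by (simp add: \<sigma>_eq del: compose_end.simps)
  qed
qed

end

section \<open>The Hochschild complex\<close>

definition coface ::
  "('o, 'm) cat \<Rightarrow> ('o, 'm, 'a, 'k, 'x) gcat \<Rightarrow> nat \<Rightarrow>
   (('o, 'm, 'a) gsimplex \<Rightarrow> 'x list \<Rightarrow> 'x) \<Rightarrow> ('o, 'm, 'a) gsimplex \<Rightarrow> 'x list \<Rightarrow> 'x"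
  where "coface U a i \<phi> \<sigma> fs = compose_end U a i \<sigma> fs (\<phi> (face U i \<sigma>) (face_args a i \<sigma> fs))"

lemma hochschild_module_simps:
  "carrier (hochschild_module k U a n) = (\<Pi>\<^sub>E \<sigma>\<in>gsimplices U a n. carrier (cochains k U a \<sigma>))"
  "\<zero>\<^bsub>hochschild_module k U a n\<^esub> = (\<lambda>\<sigma>\<in>gsimplices U a n. \<zero>\<^bsub>cochains k U a \<sigma>\<^esub>)"
  by (simp_all add: hochschild_module_def prod_module_simps)

lemma hochschild_component:
  "\<sigma> \<in> gsimplices U a n \<Longrightarrow> (\<lambda>\<phi>. \<phi> \<sigma>) \<in> mod_hom k (hochschild_module k U a n) (cochains k U a \<sigma>)"
  unfolding hochschild_module_def
  by (rule prod_module_proj[where M = "\<lambda>\<sigma>. cochains k U a \<sigma>"])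

lemma hochschild_eval:
  "\<lbrakk>\<sigma> \<in> gsimplices U a n; fs \<in> args a \<sigma>\<rbrakk>
    \<Longrightarrow> (\<lambda>\<phi>. \<phi> \<sigma> fs) \<in> mod_hom k (hochschild_module k U a n) (target U a \<sigma>)"
  by (rule mod_hom_comp[OF hochschild_component multilinear_module_eval])

context graded_category
begin

lemma module_hochschild:
  "cring k \<Longrightarrow> module k (hochschild_module k U a n)"
  unfolding hochschild_module_def by (rule module_prod_module) (auto intro: module_cochains)

lemma coface_linear:
  assumes "\<sigma> \<in> gsimplices U a (Suc n)" "fs \<in> args a \<sigma>" "i \<le> Suc n"
  shows "(\<lambda>\<phi>. coface U a i \<phi> \<sigma> fs) \<in> mod_hom k (hochschild_module k U a n) (target U a \<sigma>)"
  unfolding coface_def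
  by (rule mod_hom_comp[OF hochschild_eval[OF face_in[OF assms(1,3)] face_args_in[OF assms(1,3,2)]]
        compose_end_linear[OF assms]])

lemma coface_closed:
  assumes "\<sigma> \<in> gsimplices U a (Suc n)" "fs \<in> args a \<sigma>" "i \<le> Suc n"
    and "\<phi> \<in> carrier (hochschild_module k U a n)"
  shows "coface U a i \<phi> \<sigma> fs \<in> carrier (target U a \<sigma>)"
  using mod_hom_closed[OF coface_linear[OF assms(1-3)] assms(4)] .

text \<open>
  The sign \<open>n + 1 - i\<close> is replaced by \<open>n + 1 + i\<close>, which has the same parity and avoids
  truncated subtraction.
\<close>

lemma hochschild_term_eq:
  assumes \<sigma>: "\<sigma> \<in> gsimplices U a (Suc n)" and fs: "fs \<in> args a \<sigma>"
    and \<phi>: "\<phi> \<in> carrier (hochschild_module k U a n)"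
  shows "hochschild_term U a n \<phi> \<sigma> fs =
    finsum (target U a \<sigma>) (\<lambda>i. signed (target U a \<sigma>) (Suc n + i) (coface U a i \<phi> \<sigma> fs)) {..Suc n}"
proof -
  obtain Us us As where \<sigma>_eq: "\<sigma> = (Us, us, As)" by (cases \<sigma>)
  define M where "M = target U a \<sigma>"
  interpret M: module k M unfolding M_def using \<sigma> by (rule module_target)
  have len: "length Us = Suc (Suc n)" "length us = Suc n" "length As = Suc (Suc n)" "length fs = Suc n"
    using \<sigma> fs by (auto simp: \<sigma>_eq gsimplices_iff args_iff)
  have nonempty: "Us \<noteq> []" "us \<noteq> []" "As \<noteq> []" "fs \<noteq> []"
    using len by auto
  note ends = hd_conv_nth[OF nonempty(2)] hd_conv_nth[OF nonempty(3)] hd_conv_nth[OF nonempty(4)]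
    last_conv_nth[OF nonempty(2)] last_conv_nth[OF nonempty(3)] last_conv_nth[OF nonempty(4)]
  note contract_n = contract_last[of us, unfolded len] contract_last[of fs, unfolded len]
  define t where "t i = signed M (Suc n + i) (coface U a i \<phi> \<sigma> fs)" for i
  have t: "t i \<in> carrier M" if "i \<le> Suc n" for i
    unfolding t_def M_def
    using that \<sigma> fs \<phi> by (intro signed_closed[OF module_target[OF \<sigma>]] coface_closed)
  have last: "GComp a (last us) (total U (butlast Us) (butlast us)) (hd As) (As ! n) (last As)
        (last fs) (\<phi> (butlast Us, butlast us, butlast As) (butlast fs)) = t (Suc n)"
    using len by (simp add: t_def signed_def coface_def \<sigma>_eq contract_n delete_nth_last ends composite.simps)
  have first: "signed M (n + 1) (GComp a (total U (tl Us) (tl us)) (hd us) (hd As) (As ! 1) (last As)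
        (\<phi> (tl Us, tl us, tl As) (tl fs)) (hd fs)) = t 0"
    using len by (simp add: t_def coface_def \<sigma>_eq contract_0 delete_nth_0 ends composite.simps)
  have mid: "signed M (n + 1 - i)
          (\<phi> (delete_nth i Us, merge_nth i (Comp U) us, delete_nth i As)
             (merge_nth i
               (GComp a (us ! i) (us ! (i - 1)) (As ! (i - 1)) (As ! i) (As ! (i + 1))) fs)) = t i"
    if "i \<in> {1..n}" for i
    using that len
    by (auto simp: t_def coface_def \<sigma>_eq contract_merge intro!: signed_cong)
  have "hochschild_term U a n \<phi> \<sigma> fs = t (Suc n) \<oplus>\<^bsub>M\<^esub> finsum M t {1..n} \<oplus>\<^bsub>M\<^esub> t 0"
  proof -
    have "finsum M (\<lambda>i. signed M (n + 1 - i)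
          (\<phi> (delete_nth i Us, merge_nth i (Comp U) us, delete_nth i As)
             (merge_nth i
               (GComp a (us ! i) (us ! (i - 1)) (As ! (i - 1)) (As ! i) (As ! (i + 1))) fs))) {1..n}
       = finsum M t {1..n}"
      using t by (intro M.finsum_cong' mid) auto
    then show ?thesis
      using last first by (simp only: \<sigma>_eq hochschild_term.simps Let_def M_def)
  qed
  also have "\<dots> = t (Suc n) \<oplus>\<^bsub>M\<^esub> finsum M t {..n}"
  proof -
    have "t (Suc n) \<in> carrier M" "t 0 \<in> carrier M" "finsum M t {1..n} \<in> carrier M"
      using t by (auto intro!: M.finsum_closed)
    moreover have "t 0 \<oplus>\<^bsub>M\<^esub> finsum M t {1..n} = finsum M t {..n}"
      using t M.add.finprod_0'[of t n] by (simp add: Pi_iff)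
    ultimately show ?thesis
      by (metis M.a_assoc M.a_comm)
  qed
  also have "\<dots> = finsum M t {..Suc n}"
    using t by (intro M.finsum_Suc[symmetric]) auto
  finally show ?thesis unfolding t_def M_def .
qed

lemma hochschild_term_linear:
  assumes "cring k" "\<sigma> \<in> gsimplices U a (Suc n)" "fs \<in> args a \<sigma>"
  shows "(\<lambda>\<phi>. hochschild_term U a n \<phi> \<sigma> fs) \<in> mod_hom k (hochschild_module k U a n) (target U a \<sigma>)"
proof (rule mod_hom_cong[OF hochschild_term_eq module_hochschild])
  show "(\<lambda>\<phi>. finsum (target U a \<sigma>) (\<lambda>i. signed (target U a \<sigma>) (Suc n + i) (coface U a i \<phi> \<sigma> fs)) {..Suc n})
      \<in> mod_hom k (hochschild_module k U a n) (target U a \<sigma>)"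
    using assms
    by (intro finsum_in_mod_hom signed_in_mod_hom module_target[OF assms(2)] coface_linear) auto
qed (use assms in auto)

lemma hochschild_term_multilinear:
  assumes \<sigma>: "\<sigma> \<in> gsimplices U a (Suc n)" and \<phi>: "\<phi> \<in> carrier (hochschild_module k U a n)"
  shows "(\<lambda>fs\<in>args a \<sigma>. hochschild_term U a n \<phi> \<sigma> fs) \<in> carrier (cochains k U a \<sigma>)"
proof -
  let ?M = "target U a \<sigma>"
  note M = module_target[OF \<sigma>]
  have len: "length (factors a \<sigma>) = Suc n"
    using \<sigma> by (cases \<sigma>) (auto simp: gsimplices_iff)
  have "(\<lambda>x. (\<lambda>fs\<in>args a \<sigma>. hochschild_term U a n \<phi> \<sigma> fs) (fs[l := x])) \<in> mod_hom k (factors a \<sigma> ! l) ?M"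
    if l: "l < length (factors a \<sigma>)" and fs: "fs \<in> args a \<sigma>" for l fs
  proof (rule mod_hom_cong)
    show "(\<lambda>fs\<in>args a \<sigma>. hochschild_term U a n \<phi> \<sigma> fs) (fs[l := x]) =
      finsum ?M (\<lambda>i. signed ?M (Suc n + i) (coface U a i \<phi> \<sigma> (fs[l := x]))) {..Suc n}"
      if "x \<in> carrier (factors a \<sigma> ! l)" for x
    proof -
      have "fs[l := x] \<in> args a \<sigma>"
        using that l fs by (simp add: list_update_in_listset)
      then show ?thesis using hochschild_term_eq[OF \<sigma> _ \<phi>] by simp
    qed
    show "module k (factors a \<sigma> ! l)"
      using module_factors[OF \<sigma> l] .
    have "(\<lambda>x. coface U a i \<phi> \<sigma> (fs[l := x])) \<in> mod_hom k (factors a \<sigma> ! l) ?M" if "i \<le> Suc n" for i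
      unfolding coface_def
      using \<sigma> that \<phi> face_in[OF \<sigma> that] fs l len
      by (intro coface_multilinear) (auto simp: hochschild_module_simps)
    then show "(\<lambda>x. finsum ?M (\<lambda>i. signed ?M (Suc n + i) (coface U a i \<phi> \<sigma> (fs[l := x]))) {..Suc n})
        \<in> mod_hom k (factors a \<sigma> ! l) ?M"
      by (intro finsum_in_mod_hom signed_in_mod_hom M) auto
  qed
  moreover have "hochschild_term U a n \<phi> \<sigma> fs \<in> carrier ?M" if "fs \<in> args a \<sigma>" for fs
    unfolding hochschild_term_eq[OF \<sigma> that \<phi>]
    using coface_closed[OF \<sigma> that _ \<phi>]
    by (intro abelian_monoid.finsum_closed[OF abelian_group.axioms(1)[OF module.axioms(2)[OF M]]])
      (auto intro!: signed_closed[OF M])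
  ultimately show ?thesis
    by (auto simp: multilinear_carrier)
qed

lemma hochschild_diff_linear:
  assumes "cring k"
  shows "hochschild_diff U a n \<in> mod_hom k (hochschild_module k U a n) (hochschild_module k U a (Suc n))"
  unfolding hochschild_module_def[of k U a "Suc n"]
proof (rule mod_hom_prod_moduleI[OF _ module_hochschild[OF assms]])
  show "hochschild_diff U a n \<phi> \<in> extensional (gsimplices U a (Suc n))" for \<phi>
    by (simp add: hochschild_diff_def)
  fix \<sigma> assume \<sigma>: "\<sigma> \<in> gsimplices U a (Suc n)"
  then have "(\<lambda>\<phi>. hochschild_diff U a n \<phi> \<sigma>) = (\<lambda>\<phi>. \<lambda>fs\<in>args a \<sigma>. hochschild_term U a n \<phi> \<sigma> fs)"
    by (simp add: hochschild_diff_def)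
  moreover have "\<dots> \<in> mod_hom k (hochschild_module k U a n) (cochains k U a \<sigma>)"
    using \<sigma> hochschild_term_linear[OF assms \<sigma>]
    by (intro mod_hom_multilinear_moduleI hochschild_term_multilinear module_hochschild assms) auto
  ultimately show "(\<lambda>\<phi>. hochschild_diff U a n \<phi> \<sigma>)
      \<in> mod_hom k (hochschild_module k U a n) (cochains k U a \<sigma>)"
    by simp
qed

text \<open>
  Composing at the ends is linear, so it passes through the inner sum; this turns the
  squared differential into a double sum of the shape treated by \<open>alternating_double_sum\<close>.
\<close>

lemma hochschild_diff_diff:
  assumes "cring k" and \<phi>: "\<phi> \<in> carrier (hochschild_module k U a n)"
  shows "hochschild_diff U a (Suc n) (hochschild_diff U a n \<phi>)
       = \<zero>\<^bsub>hochschild_module k U a (Suc (Suc n))\<^esub>"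
proof -
  let ?\<psi> = "hochschild_diff U a n \<phi>"
  have \<psi>: "?\<psi> \<in> carrier (hochschild_module k U a (Suc n))"
    using mod_hom_closed[OF hochschild_diff_linear[OF assms(1)] \<phi>] .
  have "hochschild_term U a (Suc n) ?\<psi> \<sigma> fs = \<zero>\<^bsub>target U a \<sigma>\<^esub>"
    if \<sigma>: "\<sigma> \<in> gsimplices U a (Suc (Suc n))" and fs: "fs \<in> args a \<sigma>" for \<sigma> fs
  proof -
    let ?M = "target U a \<sigma>"
    note M = module_target[OF \<sigma>]
    interpret M: module k ?M by (rule M)
    define T where "T j i = compose_end U a j \<sigma> fs (coface U a i \<phi> (face U j \<sigma>) (face_args a j \<sigma> fs))" for j i
    have face: "face U j \<sigma> \<in> gsimplices U a (Suc n)"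
      and fargs: "face_args a j \<sigma> fs \<in> args a (face U j \<sigma>)"
      and lin: "compose_end U a j \<sigma> fs \<in> mod_hom k (target U a (face U j \<sigma>)) ?M"
      if "j \<le> Suc (Suc n)" for j
      using face_in[OF \<sigma> that] face_args_in[OF \<sigma> that fs] compose_end_linear[OF \<sigma> fs that] .
    have cl: "coface U a i \<phi> (face U j \<sigma>) (face_args a j \<sigma> fs) \<in> carrier (target U a (face U j \<sigma>))"
      if "j \<le> Suc (Suc n)" "i \<le> Suc n" for i j
      using coface_closed[OF face[OF that(1)] fargs[OF that(1)] that(2) \<phi>] .
    have T: "T j i \<in> carrier ?M" if "i \<le> Suc n" "j \<le> Suc (Suc n)" for i j
      unfolding T_def using mod_hom_closed[OF lin cl] that by blast
    have step: "coface U a j ?\<psi> \<sigma> fs = finsum ?M (\<lambda>i. signed ?M (Suc n + i) (T j i)) {..Suc n}"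
      if j: "j \<le> Suc (Suc n)" for j
    proof -
      let ?N = "target U a (face U j \<sigma>)"
      note N = module_target[OF face[OF j]]
      have "coface U a j ?\<psi> \<sigma> fs = compose_end U a j \<sigma> fs
          (finsum ?N (\<lambda>i. signed ?N (Suc n + i) (coface U a i \<phi> (face U j \<sigma>) (face_args a j \<sigma> fs))) {..Suc n})"
        unfolding coface_def[of U a j]
        using face[OF j] fargs[OF j] hochschild_term_eq[OF face[OF j] fargs[OF j] \<phi>]
        by (simp add: hochschild_diff_def)
      also have "\<dots> = finsum ?M (\<lambda>i. compose_end U a j \<sigma> fs
          (signed ?N (Suc n + i) (coface U a i \<phi> (face U j \<sigma>) (face_args a j \<sigma> fs)))) {..Suc n}"
        using cl[OF j] by (intro mod_hom_finsum[OF N M lin[OF j]] signed_closed[OF N]) auto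
      also have "\<dots> = finsum ?M (\<lambda>i. signed ?M (Suc n + i) (T j i)) {..Suc n}"
        using cl[OF j] T[OF _ j]
        by (intro M.finsum_cong') (auto simp: T_def mod_hom_signed[OF N M lin[OF j]] intro!: signed_closed[OF M])
      finally show ?thesis .
    qed
    \<comment> \<open>The exponents add up to \<open>(n + 2 + j) + (n + 1 + i)\<close>, which has the parity of \<open>i + j + 1\<close>.\<close>
    have sgn: "signed ?M (Suc (Suc n) + j) (finsum ?M (\<lambda>i. signed ?M (Suc n + i) (T j i)) {..Suc n})
        = finsum ?M (\<lambda>i. signed ?M (Suc (i + j)) (T j i)) {..Suc n}"
      if j: "j \<le> Suc (Suc n)" for j
    proof -
      have "signed ?M (Suc (Suc n) + j) (finsum ?M (\<lambda>i. signed ?M (Suc n + i) (T j i)) {..Suc n})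
        = finsum ?M (\<lambda>i. signed ?M (Suc (Suc n) + j) (signed ?M (Suc n + i) (T j i))) {..Suc n}"
        using T[OF _ j]
        by (intro mod_hom_finsum[OF M M signed_in_mod_hom[OF M mod_hom_id]])
          (auto intro!: signed_closed[OF M])
      also have "\<dots> = finsum ?M (\<lambda>i. signed ?M (Suc (i + j)) (T j i)) {..Suc n}"
        using T[OF _ j]
        by (intro M.finsum_cong')
          (auto simp: signed_signed[OF M] intro!: signed_closed[OF M] signed_cong)
      finally show ?thesis .
    qed
    have swap: "T j i = T i (j - 1)" if "i < j" "j \<le> Suc (Suc n)" for i j
    proof -
      have "face U i (face U j \<sigma>) \<in> gsimplices U a n"
          "face_args a i (face U j \<sigma>) (face_args a j \<sigma> fs) \<in> args a (face U i (face U j \<sigma>))"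
        using that face_in[OF face] face_args_in[OF face _ fargs] by auto
      then have "\<phi> (face U i (face U j \<sigma>)) (face_args a i (face U j \<sigma>) (face_args a j \<sigma> fs))
          \<in> carrier (target U a (face U i (face U j \<sigma>)))"
        using mod_hom_closed[OF hochschild_eval \<phi>] by blast
      from compose_end_compose_end[OF \<sigma> fs that this] show ?thesis
        by (simp add: T_def coface_def face_face[OF category_axioms \<sigma> that] face_args_face[OF \<sigma> fs that])
    qed
    have "hochschild_term U a (Suc n) ?\<psi> \<sigma> fs =
        finsum ?M (\<lambda>j. signed ?M (Suc (Suc n) + j) (coface U a j ?\<psi> \<sigma> fs)) {..Suc (Suc n)}"
      by (rule hochschild_term_eq[OF \<sigma> fs \<psi>])
    also have "\<dots> = finsum ?M (\<lambda>j. finsum ?M (\<lambda>i. signed ?M (Suc (i + j)) (T j i)) {..Suc n}) {..Suc (Suc n)}"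
      using T by (intro M.finsum_cong')
        (auto simp: step sgn intro!: M.finsum_closed signed_closed[OF M] simp del: add_Suc)
    also have "\<dots> = \<zero>\<^bsub>?M\<^esub>"
      by (rule alternating_double_sum[OF M, of "Suc n" T]) (fact T, fact swap)
    finally show ?thesis .
  qed
  then show ?thesis
    unfolding hochschild_diff_def[of U a "Suc n"] hochschild_module_simps
    by (intro restrict_ext) (auto simp: multilinear_module_def Let_def intro!: restrict_ext)
qed

theorem cochain_complex_hochschild:
  "cring k \<Longrightarrow> cochain_complex k (hochschild_cplx k U a)"
  by (simp add: cochain_complex_def hochschild_cplx_def module_hochschild hochschild_diff_linear
      hochschild_diff_diff)

end

section \<open>Restriction to a subcategory\<close>

lemma cochain_map_pair:
  assumes "cochain_map k C D f" "cochain_map k C E g"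
  shows "cochain_map k C (dsum_cplx D E) (\<lambda>n x. (f n x, g n x))"
  using assms by (auto simp: cochain_map_def dsum_cplx_def intro: mod_hom_pair)

lemma cochain_map_difference:
  assumes E: "cochain_complex k E" and f: "cochain_map k C E f" and g: "cochain_map k D E g"
  shows "cochain_map k (dsum_cplx C D) E (\<lambda>n (x, y). \<ominus>\<^bsub>Deg E n\<^esub> f n x \<oplus>\<^bsub>Deg E n\<^esub> g n y)"
proof -
  have E': "module k (Deg E n)" "Diff E n \<in> mod_hom k (Deg E n) (Deg E (Suc n))" for n
    using E by (auto simp: cochain_complex_def)
  have lin: "f n \<in> mod_hom k (Deg C n) (Deg E n)" "g n \<in> mod_hom k (Deg D n) (Deg E n)" for n
    using f g by (auto simp: cochain_map_def)
  have "(\<lambda>p. \<ominus>\<^bsub>Deg E n\<^esub> f n (fst p) \<oplus>\<^bsub>Deg E n\<^esub> g n (snd p))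
      \<in> mod_hom k (dsum_module (Deg C n) (Deg D n)) (Deg E n)" for n
    by (intro add_in_mod_hom minus_in_mod_hom E' mod_hom_comp[OF dsum_module_fst lin(1)]
        mod_hom_comp[OF dsum_module_snd lin(2)])
  moreover have "\<ominus>\<^bsub>Deg E (Suc n)\<^esub> f (Suc n) (Diff C n x) \<oplus>\<^bsub>Deg E (Suc n)\<^esub> g (Suc n) (Diff D n y)
      = Diff E n (\<ominus>\<^bsub>Deg E n\<^esub> f n x \<oplus>\<^bsub>Deg E n\<^esub> g n y)"
    if x: "x \<in> carrier (Deg C n)" and y: "y \<in> carrier (Deg D n)" for n x y
  proof -
    have fx: "f n x \<in> carrier (Deg E n)" and gy: "g n y \<in> carrier (Deg E n)"
      using lin x y by (auto intro: mod_hom_closed)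
    have "\<ominus>\<^bsub>Deg E n\<^esub> f n x \<in> carrier (Deg E n)"
      using mod_hom_closed[OF minus_in_mod_hom[OF E'(1) mod_hom_id] fx] .
    then show ?thesis
      using f g x y fx gy mod_hom_minus[OF E'(1) E'(1) E'(2)]
      by (auto simp: cochain_map_def mod_hom_add[OF E'(2)])
  qed
  ultimately show ?thesis
    by (auto simp: cochain_map_def dsum_cplx_def dsum_module_simps case_prod_unfold)
qed

lemma gcat_restrict_restrict:
  "\<lbrakk>Obj W \<subseteq> Obj V; Arr W \<subseteq> Arr V\<rbrakk> \<Longrightarrow> gcat_restrict W (gcat_restrict V a) = gcat_restrict W a"
  by (auto simp: gcat_restrict_def Int_absorb1 fun_eq_iff restrict_def)

lemma subcategory_cat_inter:
  assumes "subcategory V U" "subcategory W U"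
  shows "subcategory (cat_inter V W) V" "subcategory (cat_inter V W) W" "subcategory (cat_inter V W) U"
proof -
  interpret V: category V using assms(1) by (simp add: subcategory_def)
  interpret W: category W using assms(2) by (simp add: subcategory_def)
  have eq: "Dom V v = Dom W v" "Cod V v = Cod W v" if "v \<in> Arr V" "v \<in> Arr W" for v
    using assms that by (auto simp: subcategory_def)
  have eqI: "Ide V X = Ide W X" if "X \<in> Obj V" "X \<in> Obj W" for X
    using assms that by (auto simp: subcategory_def)
  have eqC: "Comp V w v = Comp W w v"
    if "v \<in> Arr V" "v \<in> Arr W" "w \<in> Arr V" "w \<in> Arr W" "Cod V v = Dom V w" for v w
    using assms that eq by (auto simp: subcategory_def)
  have cat: "category (cat_inter V W)"
  proof
    fix u v assume "u \<in> Arr (cat_inter V W)" "v \<in> Arr (cat_inter V W)"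
      "Cod (cat_inter V W) u = Dom (cat_inter V W) v"
    then show "Comp (cat_inter V W) v u \<in> Arr (cat_inter V W)"
      using V.Comp_in[of u v] W.Comp_in[of u v] eqC[of u v] eq by (auto simp: cat_inter_def)
  next
    fix X assume "X \<in> Obj (cat_inter V W)"
    then show "Ide (cat_inter V W) X \<in> Arr (cat_inter V W)"
      using V.Ide_in[of X] W.Ide_in[of X] eqI[of X] by (auto simp: cat_inter_def)
  next
    fix u assume "u \<in> Arr (cat_inter V W)"
    then show "Dom (cat_inter V W) u \<in> Obj (cat_inter V W)" "Cod (cat_inter V W) u \<in> Obj (cat_inter V W)"
      using V.Dom_in[of u] W.Dom_in[of u] V.Cod_in[of u] W.Cod_in[of u] eq[of u] by (auto simp: cat_inter_def)
  qed (auto simp: cat_inter_def V.Dom_Ide V.Cod_Ide V.Dom_Comp V.Cod_Comp V.Comp_Ide_left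
      V.Comp_Ide_right V.Comp_assoc)
  show "subcategory (cat_inter V W) V"
    using cat by (auto simp: subcategory_def cat_inter_def)
  show "subcategory (cat_inter V W) W"
    using cat eq eqI eqC by (auto simp: subcategory_def cat_inter_def)
  show "subcategory (cat_inter V W) U"
    using cat assms by (auto simp: subcategory_def cat_inter_def)
qed

context graded_category
begin

context
  fixes V :: "('o, 'm) cat"
  assumes sub: "subcategory V U"
begin

lemma category_sub: "category V"
  and Obj_sub: "X \<in> Obj V \<Longrightarrow> X \<in> Obj U"
  and Arr_sub: "v \<in> Arr V \<Longrightarrow> v \<in> Arr U"
  and Dom_sub: "v \<in> Arr V \<Longrightarrow> Dom V v = Dom U v"
  and Cod_sub: "v \<in> Arr V \<Longrightarrow> Cod V v = Cod U v"
  and Ide_sub: "X \<in> Obj V \<Longrightarrow> Ide V X = Ide U X"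
  and Comp_sub: "\<lbrakk>v \<in> Arr V; w \<in> Arr V; Cod U v = Dom U w\<rbrakk> \<Longrightarrow> Comp V w v = Comp U w v"
  using sub by (auto simp: subcategory_def)

lemma Dom_sub_in: "v \<in> Arr V \<Longrightarrow> Dom U v \<in> Obj V"
  and Cod_sub_in: "v \<in> Arr V \<Longrightarrow> Cod U v \<in> Obj V"
  and Ide_sub_in: "X \<in> Obj V \<Longrightarrow> Ide U X \<in> Arr V"
  and Comp_sub_in: "\<lbrakk>v \<in> Arr V; w \<in> Arr V; Cod U v = Dom U w\<rbrakk> \<Longrightarrow> Comp U w v \<in> Arr V"
  using category.Dom_in[OF category_sub, of v] category.Cod_in[OF category_sub, of v]
    category.Ide_in[OF category_sub, of X] category.Comp_in[OF category_sub, of v w]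
  by (auto simp: Dom_sub Cod_sub Ide_sub Comp_sub)

lemma gcat_restrict_simps:
  "X \<in> Obj V \<Longrightarrow> Fib (gcat_restrict V a) X = Fib a X"
  "v \<in> Arr V \<Longrightarrow> GHom (gcat_restrict V a) v = GHom a v"
  "\<lbrakk>v \<in> Arr V; w \<in> Arr V\<rbrakk> \<Longrightarrow> GComp (gcat_restrict V a) w v = GComp a w v"
  "X \<in> Obj V \<Longrightarrow> GIde (gcat_restrict V a) X = GIde a X"
  by (simp_all add: gcat_restrict_def)

lemmas sub_simps = gcat_restrict_simps Dom_sub Cod_sub Ide_sub Comp_sub
  Dom_sub_in Cod_sub_in Ide_sub_in Comp_sub_in Obj_sub Arr_sub

text \<open>
  The restriction is itself a graded category, so the results on the Hochschild complex apply
  to it directly.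
\<close>

lemma graded_category_restrict: "graded_category k V (gcat_restrict V a)"
proof (intro graded_category.intro category_sub graded_category_axioms.intro, goal_cases)
  case 1 then show ?case by (simp add: sub_simps GHom_module)
next
  case 2 then show ?case by (simp add: sub_simps GComp_linear_right)
next
  case 3 then show ?case by (simp add: sub_simps GComp_linear_left)
next
  case 4 then show ?case by (simp add: sub_simps GIde_in)
next
  case 5 then show ?case by (simp add: sub_simps Dom_Comp Cod_Comp GComp_assoc)
next
  case 6 then show ?case by (simp add: sub_simps GComp_GIde_left)
next
  case 7 then show ?case by (simp add: sub_simps GComp_GIde_right)
qed

lemma gsimplices_restrict:
  "(Us, us, As) \<in> gsimplices V (gcat_restrict V a) n \<longleftrightarrow>
     (Us, us, As) \<in> gsimplices U a n \<and> (Us, us) \<in> nerve V n"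
  by (auto simp: gsimplices_iff nerve_def subset_eq all_set_conv_all_nth less_Suc_eq_le sub_simps)

lemma gsimplices_restrict_subset: "gsimplices V (gcat_restrict V a) n \<subseteq> gsimplices U a n"
  using gsimplices_restrict by auto

lemma factors_restrict:
  "\<sigma> \<in> gsimplices V (gcat_restrict V a) n \<Longrightarrow> factors (gcat_restrict V a) \<sigma> = factors a \<sigma>"
  by (cases \<sigma>) (auto simp: gsimplices_iff factors.simps sub_simps)

text \<open>
  Closure of the subcategory under composition and identities is what makes the target of a
  component, and the composites labelling its cofaces, the same in both categories.
\<close>

lemma composite_restrict:
  assumes "\<sigma> \<in> gsimplices V (gcat_restrict V a) n"
  shows "composite V \<sigma> = composite U \<sigma> \<and> composite U \<sigma> \<in> Arr V"
  using assms
proof (induction n arbitrary: \<sigma>)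
  case 0
  then show ?case
    by (cases \<sigma>) (auto simp: gsimplices_iff composite.simps total_def hd_conv_nth sub_simps
        simp flip: length_greater_0_conv)
next
  case (Suc n)
  obtain Us us As where \<sigma>: "\<sigma> = (Us, us, As)" by (cases \<sigma>)
  note s = Suc.prems[unfolded \<sigma>]
  have sU: "(Us, us, As) \<in> gsimplices U a (Suc n)"
    using s gsimplices_restrict_subset by blast
  have len: "length us = Suc n"
    using s by (simp add: gsimplices_iff)
  have last: "contract (Suc n) p us = butlast us" for p
    using contract_last[of us p] len by simp
  have face: "face V (Suc n) \<sigma> = face U (Suc n) \<sigma>"
    by (simp add: \<sigma> last)
  have IH: "composite V (face U (Suc n) \<sigma>) = composite U (face U (Suc n) \<sigma>)"
      "composite U (face U (Suc n) \<sigma>) \<in> Arr V"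
    using Suc.IH[OF face_in_gsimplices[OF category_sub Suc.prems le_refl]] by (simp_all add: face)
  have "Cod U (composite U (face U (Suc n) \<sigma>)) = Dom U (us ! n)" "us ! n \<in> Arr V"
    using composite_in[OF face_in[OF sU le_refl]] sU s
    by (auto simp: \<sigma> gsimplices_iff nth_delete_nth)
  then show ?case
    using category.composite_last[OF category_sub s] composite_last[OF sU] IH face
    by (simp add: \<sigma> sub_simps)
qed

lemma target_restrict:
  assumes "\<sigma> \<in> gsimplices V (gcat_restrict V a) n"
  shows "target V (gcat_restrict V a) \<sigma> = target U a \<sigma>"
  using assms composite_restrict[OF assms]
  by (cases \<sigma>) (auto simp: target.simps composite.simps sub_simps)

lemma face_restrict:
  assumes "\<sigma> \<in> gsimplices V (gcat_restrict V a) (Suc n)" "i \<le> Suc n"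
  shows "face V i \<sigma> = face U i \<sigma>"
proof -
  obtain Us us As where \<sigma>: "\<sigma> = (Us, us, As)" by (cases \<sigma>)
  have s: "(Us, us, As) \<in> gsimplices U a (Suc n)"
    using assms(1) gsimplices_restrict_subset unfolding \<sigma> by blast
  show ?thesis
    using assms s by (auto simp: \<sigma> gsimplices_iff contract_def intro!: Comp_sub)
qed

lemma face_args_restrict:
  assumes "\<sigma> \<in> gsimplices V (gcat_restrict V a) (Suc n)" "i \<le> Suc n" "fs \<in> args a \<sigma>"
  shows "face_args (gcat_restrict V a) i \<sigma> fs = face_args a i \<sigma> fs"
  using assms
  by (cases \<sigma>) (auto simp: gsimplices_iff args_iff contract_def sub_simps)

lemma compose_end_restrict:
  assumes \<sigma>: "\<sigma> \<in> gsimplices V (gcat_restrict V a) (Suc n)" and i: "i \<le> Suc n"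
  shows "compose_end V (gcat_restrict V a) i \<sigma> fs = compose_end U a i \<sigma> fs"
proof -
  obtain Us us As where \<sigma>_eq: "\<sigma> = (Us, us, As)" by (cases \<sigma>)
  have "face V i \<sigma> = face U i \<sigma>"
    by (rule face_restrict[OF \<sigma> i])
  moreover from this have "composite V (face U i \<sigma>) = composite U (face U i \<sigma>)" "composite U (face U i \<sigma>) \<in> Arr V"
    using composite_restrict[OF face_in_gsimplices[OF category_sub \<sigma> i]] by simp_all
  ultimately show ?thesis
    using \<sigma> i by (auto simp: fun_eq_iff \<sigma>_eq gsimplices_iff sub_simps)
qed

lemma hochschild_proj_linear:
  assumes "cring k"
  shows "hochschild_proj V a n
    \<in> mod_hom k (hochschild_module k U a n) (hochschild_module k V (gcat_restrict V a) n)"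
  unfolding hochschild_module_def[of k V]
proof (rule mod_hom_prod_moduleI[OF _ module_hochschild[OF assms]])
  fix \<sigma> assume \<sigma>: "\<sigma> \<in> gsimplices V (gcat_restrict V a) n"
  then have "\<sigma> \<in> gsimplices U a n"
    using gsimplices_restrict_subset by blast
  from hochschild_component[OF this]
  show "(\<lambda>\<phi>. hochschild_proj V a n \<phi> \<sigma>)
      \<in> mod_hom k (hochschild_module k U a n) (cochains k V (gcat_restrict V a) \<sigma>)"
    using \<sigma> by (simp add: hochschild_proj_def factors_restrict target_restrict)
qed (simp add: hochschild_proj_def)

lemma hochschild_proj_diff:
  assumes "cring k" and \<phi>: "\<phi> \<in> carrier (hochschild_module k U a n)"
  shows "hochschild_proj V a (Suc n) (hochschild_diff U a n \<phi>)
       = hochschild_diff V (gcat_restrict V a) n (hochschild_proj V a n \<phi>)"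
proof -
  interpret V: graded_category k V "gcat_restrict V a"
    by (rule graded_category_restrict)
  let ?\<psi> = "hochschild_proj V a n \<phi>"
  have \<psi>: "?\<psi> \<in> carrier (hochschild_module k V (gcat_restrict V a) n)"
    using mod_hom_closed[OF hochschild_proj_linear[OF assms(1)] \<phi>] .
  have "hochschild_term V (gcat_restrict V a) n ?\<psi> \<sigma> fs = hochschild_term U a n \<phi> \<sigma> fs"
    if \<sigma>: "\<sigma> \<in> gsimplices V (gcat_restrict V a) (Suc n)" and fs: "fs \<in> args a \<sigma>" for \<sigma> fs
  proof -
    have \<sigma>U: "\<sigma> \<in> gsimplices U a (Suc n)"
      using \<sigma> gsimplices_restrict_subset by blast
    interpret M: module k "target U a \<sigma>"
      using module_target[OF \<sigma>U] .
    have "coface V (gcat_restrict V a) i ?\<psi> \<sigma> fs = coface U a i \<phi> \<sigma> fs" if "i \<le> Suc n" for i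
      using V.face_in[OF \<sigma> that] face_restrict[OF \<sigma> that] face_args_restrict[OF \<sigma> that fs]
        compose_end_restrict[OF \<sigma> that]
      by (simp add: coface_def hochschild_proj_def)
    then show ?thesis
      using V.hochschild_term_eq[OF \<sigma> _ \<psi>] hochschild_term_eq[OF \<sigma>U fs \<phi>] fs
        coface_closed[OF \<sigma>U fs _ \<phi>]
      by (auto simp: target_restrict[OF \<sigma>] factors_restrict[OF \<sigma>]
          intro!: M.finsum_cong' signed_closed[OF M.module_axioms])
  qed
  then show ?thesis
    unfolding hochschild_diff_def hochschild_proj_def[of V a "Suc n"] restrict_restrict
      Int_absorb1[OF gsimplices_restrict_subset]
    by (intro restrict_ext) (simp add: factors_restrict cong: restrict_cong)
qed

lemma cochain_map_proj:
  "cring k \<Longrightarrow> cochain_map k (hochschild_cplx k U a) (hochschild_cplx k V (gcat_restrict V a))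
     (hochschild_proj V a)"
  by (simp add: cochain_map_def hochschild_cplx_def hochschild_proj_linear hochschild_proj_diff)

lemma hochschild_proj_surj:
  assumes "cring k" and \<psi>: "\<psi> \<in> carrier (hochschild_module k V (gcat_restrict V a) n)"
  obtains \<phi> where "\<phi> \<in> carrier (hochschild_module k U a n)" "hochschild_proj V a n \<phi> = \<psi>"
proof
  let ?S = "gsimplices V (gcat_restrict V a) n"
  let ?\<phi> = "\<lambda>\<sigma>\<in>gsimplices U a n. if \<sigma> \<in> ?S then \<psi> \<sigma> else \<zero>\<^bsub>cochains k U a \<sigma>\<^esub>"
  have "\<psi> \<sigma> \<in> carrier (cochains k U a \<sigma>)" if "\<sigma> \<in> ?S" for \<sigma>
    using \<psi> that by (auto simp: hochschild_module_simps PiE_iff factors_restrict target_restrict)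
  moreover have "\<zero>\<^bsub>cochains k U a \<sigma>\<^esub> \<in> carrier (cochains k U a \<sigma>)" if "\<sigma> \<in> gsimplices U a n" for \<sigma>
    using that by (intro multilinear_zero_in module_target module_factors)
  ultimately show "?\<phi> \<in> carrier (hochschild_module k U a n)"
    by (simp add: hochschild_module_simps)
  show "hochschild_proj V a n ?\<phi> = \<psi>"
    using \<psi> unfolding hochschild_proj_def restrict_restrict Int_absorb1[OF gsimplices_restrict_subset]
    by (intro extensionalityI[of _ ?S]) (auto simp: hochschild_module_simps PiE_iff)
qed

end

end

section \<open>The Mayer--Vietoris sequence\<close>

theorem mainTheorem8:
  fixes k :: "('k, 'r) ring_scheme"
    and U V1 V2 :: "('o, 'm) cat"
    and a :: "('o, 'm, 'a, 'k, 'x) gcat"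
  assumes "cring k"
    and "category U"
    and "graded_category k U a"
    and "subcategory V1 U"
    and "subcategory V2 U"
    and "infty_cover U {V1, V2}"
  defines "V \<equiv> cat_inter V1 V2"
  defines "a1 \<equiv> gcat_restrict V1 a"
  defines "a2 \<equiv> gcat_restrict V2 a"
  shows "short_exact_cplx k
    (hochschild_cplx k U a)
    (dsum_cplx (hochschild_cplx k V1 a1) (hochschild_cplx k V2 a2))
    (hochschild_cplx k V (gcat_restrict V a))
    (\<lambda>n \<phi>. (hochschild_proj V1 a n \<phi>, hochschild_proj V2 a n \<phi>))
    (\<lambda>n (\<phi>1, \<phi>2).
       \<ominus>\<^bsub>hochschild_module k V (gcat_restrict V a) n\<^esub> hochschild_proj V a1 n \<phi>1
       \<oplus>\<^bsub>hochschild_module k V (gcat_restrict V a) n\<^esub> hochschild_proj V a2 n \<phi>2)"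
proof -
  let ?aV = "gcat_restrict V a"
  interpret U: graded_category k U a by fact
  have sub: "subcategory V V1" "subcategory V V2" "subcategory V U"
    unfolding V_def using subcategory_cat_inter[OF assms(4,5)] .
  interpret V1: graded_category k V1 a1
    unfolding a1_def by (rule U.graded_category_restrict) fact
  interpret V2: graded_category k V2 a2
    unfolding a2_def by (rule U.graded_category_restrict) fact
  interpret V: graded_category k V ?aV
    by (rule U.graded_category_restrict) fact
  have restr: "gcat_restrict V a1 = ?aV" "gcat_restrict V a2 = ?aV"
    using sub by (auto simp: a1_def a2_def subcategory_def intro!: gcat_restrict_restrict)
  define S where "S n = gsimplices V ?aV n" for n
  define S1 where "S1 n = gsimplices V1 a1 n" for n
  define S2 where "S2 n = gsimplices V2 a2 n" for n
  have S_Un: "gsimplices U a n = S1 n \<union> S2 n" for n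
    using assms(6) U.gsimplices_restrict[OF assms(4)] U.gsimplices_restrict[OF assms(5)]
    by (fastforce simp: S1_def S2_def a1_def a2_def infty_cover_def gsimplices_def)
  have S_Int: "S n = S1 n \<inter> S2 n" for n
  proof -
    have "nerve V n = nerve V1 n \<inter> nerve V2 n"
      using assms(4,5) by (auto simp: nerve_def V_def cat_inter_def subcategory_def subset_iff)
    then show ?thesis
      using U.gsimplices_restrict[OF assms(4)] U.gsimplices_restrict[OF assms(5)]
        U.gsimplices_restrict[OF sub(3)]
      by (auto simp: S_def S1_def S2_def a1_def a2_def)
  qed
  have proj: "hochschild_proj V1 a n = (\<lambda>\<phi>. restrict \<phi> (S1 n))"
      "hochschild_proj V2 a n = (\<lambda>\<phi>. restrict \<phi> (S2 n))"
      "hochschild_proj V a1 n = (\<lambda>\<phi>. restrict \<phi> (S n))"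
      "hochschild_proj V a2 n = (\<lambda>\<phi>. restrict \<phi> (S n))" for n
    by (simp_all add: hochschild_proj_def[abs_def] S_def S1_def S2_def restr a1_def[symmetric] a2_def[symmetric])
  have module_V: "module k (hochschild_module k V ?aV n)" for n
    by (rule V.module_hochschild) fact
  note maps = U.cochain_map_proj[OF assms(4,1)] U.cochain_map_proj[OF assms(5,1)]
    V1.cochain_map_proj[OF sub(1) assms(1)] V2.cochain_map_proj[OF sub(2) assms(1)]
  note proj_in = mod_hom_closed[OF V1.hochschild_proj_linear[OF sub(1) assms(1)], unfolded restr]
    mod_hom_closed[OF V2.hochschild_proj_linear[OF sub(2) assms(1)], unfolded restr]
  \<comment> \<open>All components are written over \<open>U\<close>, so that cochains on the two parts can be glued.\<close>
  have carrier_U: "carrier (hochschild_module k U a n) = (\<Pi>\<^sub>E \<sigma>\<in>S1 n \<union> S2 n. carrier (cochains k U a \<sigma>))"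
    and carrier_1: "carrier (hochschild_module k V1 a1 n) = (\<Pi>\<^sub>E \<sigma>\<in>S1 n. carrier (cochains k U a \<sigma>))"
    and carrier_2: "carrier (hochschild_module k V2 a2 n) = (\<Pi>\<^sub>E \<sigma>\<in>S2 n. carrier (cochains k U a \<sigma>))" for n
    using U.factors_restrict[OF assms(4)] U.target_restrict[OF assms(4)]
      U.factors_restrict[OF assms(5)] U.target_restrict[OF assms(5)]
    by (auto simp: hochschild_module_simps S_Un S1_def[symmetric] S2_def[symmetric]
        a1_def[symmetric] a2_def[symmetric] intro!: PiE_cong)
  \<comment> \<open>The second map of the sequence, with projections in place of the pattern on pairs.\<close>
  define g where "g n p = \<ominus>\<^bsub>hochschild_module k V ?aV n\<^esub> hochschild_proj V a1 n (fst p)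
      \<oplus>\<^bsub>hochschild_module k V ?aV n\<^esub> hochschild_proj V a2 n (snd p)" for n p
  have g_zero: "g n (\<phi>1, \<phi>2) = \<zero>\<^bsub>hochschild_module k V ?aV n\<^esub> \<longleftrightarrow> restrict \<phi>1 (S n) = restrict \<phi>2 (S n)"
    if "\<phi>1 \<in> carrier (hochschild_module k V1 a1 n)" "\<phi>2 \<in> carrier (hochschild_module k V2 a2 n)" for n \<phi>1 \<phi>2
  proof -
    interpret M: module k "hochschild_module k V ?aV n" by (rule module_V)
    have "\<ominus>\<^bsub>hochschild_module k V ?aV n\<^esub> x \<oplus>\<^bsub>hochschild_module k V ?aV n\<^esub> y
        = \<zero>\<^bsub>hochschild_module k V ?aV n\<^esub> \<longleftrightarrow> x = y"
      if "x \<in> carrier (hochschild_module k V ?aV n)" "y \<in> carrier (hochschild_module k V ?aV n)" for x y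
      using that M.minus_equality M.minus_minus M.l_neg M.a_inv_closed by metis
    from this[OF proj_in(1)[OF that(1)] proj_in(2)[OF that(2)]] show ?thesis
      by (simp add: g_def proj)
  qed
  have inj: "inj_on (\<lambda>\<phi>. (hochschild_proj V1 a n \<phi>, hochschild_proj V2 a n \<phi>))
      (carrier (hochschild_module k U a n))" for n
  proof (rule inj_onI)
    fix \<phi> \<psi>
    assume "\<phi> \<in> carrier (hochschild_module k U a n)" "\<psi> \<in> carrier (hochschild_module k U a n)"
      and "(hochschild_proj V1 a n \<phi>, hochschild_proj V2 a n \<phi>) = (hochschild_proj V1 a n \<psi>, hochschild_proj V2 a n \<psi>)"
    then show "\<phi> = \<psi>"
      unfolding carrier_U proj
      by (intro PiE_ext) (auto dest: restrict_apply' simp: restrict_def fun_eq_iff split: if_splits)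
  qed
  have mid: "(\<lambda>\<phi>. (hochschild_proj V1 a n \<phi>, hochschild_proj V2 a n \<phi>)) ` carrier (hochschild_module k U a n)
      = {p \<in> carrier (dsum_module (hochschild_module k V1 a1 n) (hochschild_module k V2 a2 n)).
          g n p = \<zero>\<^bsub>hochschild_module k V ?aV n\<^esub>}" (is "?L = ?R") for n
  proof (intro equalityI subsetI)
    fix p assume "p \<in> ?L"
    then obtain \<phi> where \<phi>: "\<phi> \<in> carrier (hochschild_module k U a n)"
      and p: "p = (restrict \<phi> (S1 n), restrict \<phi> (S2 n))"
      by (auto simp: proj)
    have "restrict \<phi> (S1 n) \<in> carrier (hochschild_module k V1 a1 n)"
        "restrict \<phi> (S2 n) \<in> carrier (hochschild_module k V2 a2 n)"
      using \<phi> unfolding carrier_U carrier_1 carrier_2 by auto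
    then show "p \<in> ?R"
      using g_zero by (auto simp: p dsum_module_simps S_Int Int_commute Int_left_commute)
  next
    fix p assume p: "p \<in> ?R"
    obtain \<phi>1 \<phi>2 where p_eq: "p = (\<phi>1, \<phi>2)" by (cases p)
    have \<phi>1: "\<phi>1 \<in> carrier (hochschild_module k V1 a1 n)" and \<phi>2: "\<phi>2 \<in> carrier (hochschild_module k V2 a2 n)"
      using p by (auto simp: p_eq dsum_module_simps)
    have agree: "\<phi>1 \<sigma> = \<phi>2 \<sigma>" if "\<sigma> \<in> S1 n" "\<sigma> \<in> S2 n" for \<sigma>
    proof -
      have "restrict \<phi>1 (S n) = restrict \<phi>2 (S n)"
        using p g_zero[OF \<phi>1 \<phi>2] by (simp add: p_eq)
      then have "restrict \<phi>1 (S n) \<sigma> = restrict \<phi>2 (S n) \<sigma>" by simp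
      then show ?thesis using that by (simp add: S_Int)
    qed
    define \<phi> where "\<phi> = (\<lambda>\<sigma>\<in>S1 n \<union> S2 n. if \<sigma> \<in> S1 n then \<phi>1 \<sigma> else \<phi>2 \<sigma>)"
    have "\<phi> \<in> carrier (hochschild_module k U a n)"
      using \<phi>1 \<phi>2 unfolding carrier_U carrier_1 carrier_2 by (auto simp: \<phi>_def)
    moreover have "restrict \<phi> (S1 n) = \<phi>1"
      using \<phi>1 unfolding carrier_1
      by (auto simp: \<phi>_def PiE_iff extensional_def fun_eq_iff)
    moreover have "restrict \<phi> (S2 n) = \<phi>2"
      using \<phi>2 agree unfolding carrier_2
      by (auto simp: \<phi>_def PiE_iff extensional_def fun_eq_iff)
    ultimately show "p \<in> ?L"
      by (force simp: p_eq proj)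
  qed
  have surj: "g n ` carrier (dsum_module (hochschild_module k V1 a1 n) (hochschild_module k V2 a2 n))
      = carrier (hochschild_module k V ?aV n)" for n
  proof (intro equalityI subsetI)
    interpret M: module k "hochschild_module k V ?aV n" by (rule module_V)
    show "\<psi> \<in> carrier (hochschild_module k V ?aV n)"
      if "\<psi> \<in> g n ` carrier (dsum_module (hochschild_module k V1 a1 n) (hochschild_module k V2 a2 n))" for \<psi>
      using that proj_in by (auto simp: g_def dsum_module_simps)
    fix \<psi> assume \<psi>: "\<psi> \<in> carrier (hochschild_module k V ?aV n)"
    obtain \<phi>2 where \<phi>2: "\<phi>2 \<in> carrier (hochschild_module k V2 a2 n)" "hochschild_proj V a2 n \<phi>2 = \<psi>"
      using V2.hochschild_proj_surj[OF sub(2) assms(1), unfolded restr, OF \<psi>] by blast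
    \<comment> \<open>The second summand alone surjects; the first contributes zero.\<close>
    let ?z = "\<zero>\<^bsub>hochschild_module k V1 a1 n\<^esub>"
    have z: "?z \<in> carrier (hochschild_module k V1 a1 n)"
      using V1.module_hochschild[OF assms(1)]
      by (simp add: module_def abelian_group_def abelian_monoid.zero_closed)
    have "hochschild_proj V a1 n ?z = \<zero>\<^bsub>hochschild_module k V ?aV n\<^esub>"
      using mod_hom_zero[OF V1.module_hochschild[OF assms(1)] module_V
          V1.hochschild_proj_linear[OF sub(1) assms(1), unfolded restr]] .
    then have "g n (?z, \<phi>2) = \<psi>"
      using \<psi> \<phi>2 by (simp add: g_def)
    then show "\<psi> \<in> g n ` carrier (dsum_module (hochschild_module k V1 a1 n) (hochschild_module k V2 a2 n))"
      using z \<phi>2 by (force simp: dsum_module_simps)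
  qed
  have deg: "Deg (hochschild_cplx k W b) n = hochschild_module k W b n"
    for W :: "('o, 'm) cat" and b :: "('o, 'm, 'a, 'k, 'x) gcat" and n
    by (simp add: hochschild_cplx_def)
  have deg_dsum: "Deg (dsum_cplx C D) n = dsum_module (Deg C n) (Deg D n)"
    for C D :: "('k, ('o, 'm, 'a) gsimplex \<Rightarrow> 'x list \<Rightarrow> 'x) cplx" and n
    by (simp add: dsum_cplx_def)
  have g_map: "cochain_map k (dsum_cplx (hochschild_cplx k V1 a1) (hochschild_cplx k V2 a2))
      (hochschild_cplx k V ?aV) g"
    using cochain_map_difference[OF V.cochain_complex_hochschild[OF assms(1)]
        maps(3)[unfolded restr] maps(4)[unfolded restr]]
    by (simp add: g_def[abs_def] deg case_prod_unfold)
  have "short_exact_cplx k (hochschild_cplx k U a)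
    (dsum_cplx (hochschild_cplx k V1 a1) (hochschild_cplx k V2 a2)) (hochschild_cplx k V ?aV)
    (\<lambda>n \<phi>. (hochschild_proj V1 a n \<phi>, hochschild_proj V2 a n \<phi>)) g"
    unfolding short_exact_cplx_def
  proof (intro conjI allI)
    show "cochain_complex k (dsum_cplx (hochschild_cplx k V1 a1) (hochschild_cplx k V2 a2))"
      by (intro cochain_complex_dsum V1.cochain_complex_hochschild V2.cochain_complex_hochschild assms(1))
    show "cochain_map k (hochschild_cplx k U a) (dsum_cplx (hochschild_cplx k V1 a1) (hochschild_cplx k V2 a2))
        (\<lambda>n \<phi>. (hochschild_proj V1 a n \<phi>, hochschild_proj V2 a n \<phi>))"
      by (rule cochain_map_pair[OF maps(1)[folded a1_def] maps(2)[folded a2_def]])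
  qed (use g_map inj mid surj in \<open>simp_all add: deg deg_dsum U.cochain_complex_hochschild
        V.cochain_complex_hochschild assms(1)\<close>)
  then show ?thesis
    by (simp add: g_def[abs_def] case_prod_unfold)
qed

end
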